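(* There is an absolute constant $C>0$ such that the following holds. Let $n,m,k$ be positive integers, let $A\in\mathbb Z^{m\times n}$, $b\in\mathbb Z^m$ be such that $P=\{x\in\mathbb R^n \mid Ax\le b\}$ is a $[0,k]$-polytope, let $\alpha$ be the largest absolute value of an entry of $A$, and assume $nk\alpha\ge 2$. Let $c\in\mathbb Z^n$, and let $x^0$ be a vertex of $P$. Then the iterative algorithm with input $(P,c,x^0)$ generates a simplex path, i.e., a path along the edges of $P$ from $x^0$ to a vertex of $P$ maximizing $c^\top x$ over $P$, of length at most $C\, n^2 k\log(nk\alpha)$. (That is, the length is in $O(n^2k\log(nk\alpha))$.)
   Context: A lattice polytope is a polytope all of whose vertices have integer coordinates. A $[0,k]$-polytope in $\mathbb R^n$ is a lattice polytope contained in $[0,k]^n$. $\log$ denotes the logarithm in base $2$. $[m]:=\{1,\dots,m\}$, and $a_i^\top$ denotes the $i$-th row of $A$. Oracle: given a polytope $Q\subseteq\mathbb R^n$, a vector $w\in\mathbb Z^n$, and a vertex $v$ of $Q$, it either states that $v$ maximizes $w^\top x$ over $Q$ (when this is the case), or returns a vertex $v'$ of $Q$ adjacent to $v$ (i.e., joined to $v$ by an edge of $Q$) with $w^\top v'>w^\top v$. If $v$ is not optimal, any such adjacent vertex may be returned; the result holds for every choice. Basic algorithm$(Q,w,v)$: set $v^0:=v$; for $t=0,1,2,\dots$ call the oracle on $(Q,w,v^t)$; if it states that $v^t$ is optimal, return $v^t$; otherwise let $v^{t+1}$ be the vertex returned by the oracle. Scaling algorithm$(Q,w,v)$, for a $[0,k]$-polytope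 $Q$ and $w\neq 0$: let $\ell:=\lceil\log\|w\|_\infty\rceil$ and $w^t:=\lceil w/2^{\ell-t}\rceil$ (componentwise) for $t=0,\dots,\ell$. Set $v^{(0)}:=v$, and for $t=0,\dots,\ell$ set $v^{(t+1)}:=$ basic algorithm$(Q,w^t,v^{(t)})$. Return $v^{(\ell+1)}$. Iterative algorithm$(P,c,x^0)$: Step 0. Let $\mathcal E:=\emptyset$ and $x^*:=x^0$. Step 1. Let $\bar c$ be the orthogonal projection of $c$ onto the subspace $\{x\in\mathbb R^n\mid a_i^\top x=0 \text{ for } i\in\mathcal E\}$. If $\bar c=0$ return $x^*$; otherwise go to Step 2. Step 2. Let $\tilde c\in\mathbb Z^n$ be defined by $\tilde c_i:=\left\lfloor \frac{n^3k\alpha}{\|\bar c\|_\infty}\bar c_i\right\rfloor$ for $i=1,\dots,n$. Step 3. Consider the primal/dual pair of linear programs $$(\tilde P)\quad \max\{\tilde c^\top x \mid a_i^\top x=b_i\ (i\in\mathcal E),\ a_i^\top x\le b_i\ (i\in[m]\setminus\mathcal E)\},$$ $$(\tilde D)\quad \min\{b^\top y\mid A^\top y=\tilde c,\ y_i\ge 0\ (i\in[m]\setminus\mathcal E)\}.$$ Use the scaling algorithm on the feasible region of $(\tilde P)$ with cost $\tilde c$, starting from $x^*$, to compute an optimal vertex $\tilde x$ of $(\tilde P)$. Compute an optimal solution $\tilde y$ of $(\tilde D)$ such that (i) $\tilde y$ has at most $n$ nonzero components, and (ii) $\tilde y_j=0$ for every $j\in[m]\setminus\mathcal E$ such that $a_j$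 is a linear combination of the $a_i$, $i\in\mathcal E$. Let $\mathcal H:=\{i\mid \tilde y_i>nk\}$ and let $h\in\mathcal H\setminus\mathcal E$. Add $h$ to $\mathcal E$, set $x^*:=\tilde x$, and go back to Step 1. The simplex path generated by an algorithm is the sequence of successive vertices obtained by concatenating all the oracle moves it performs; its length is the number of edges traversed (the number of oracle calls returning a new vertex).
   Formalization: For n=1, Step 3 can find no h in H\E (e.g. P=[0,k], c=1, k≥2), so the algorithm is undefined there; a run blocked in this way counts as halted, with the path, optimality and length claims still proved. That the algorithm ends by returning in Step 1 is asserted only for n≥2. *)

theory Defs
  imports "HOL-Analysis.Analysis" "HOL-Analysis.Finite_Function_Topology"
begin

(* The dimension n has to be quantified inside the statement, because the constant in the
   bound does not depend on it.  R^n is therefore the coordinate subspace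
   coord_space n of the library's real vector space of finitely supported sequences, where
   convex, polytope, face_of and extreme_point_of are available.  Indices are 0-based: the
   coordinates are 0, ..., n - 1 and the rows of A are 0, ..., m - 1.  Integer vectors and
   matrices are functions of which only the values at these indices matter. *)

type_synonym rvec = "(nat, real) poly_mapping"
type_synonym ivec = "nat \<Rightarrow> int"
type_synonym imat = "nat \<Rightarrow> nat \<Rightarrow> int"

abbreviation coord :: "rvec \<Rightarrow> nat \<Rightarrow> real" where
  "coord x j \<equiv> Poly_Mapping.lookup x j"

definition coord_space :: "nat \<Rightarrow> rvec set" where
  "coord_space n = {x. Poly_Mapping.keys x \<subseteq> {..<n}}"

definition dotp :: "nat \<Rightarrow> ivec \<Rightarrow> rvec \<Rightarrow> real" where
  "dotp n w x = (\<Sum>j<n. real_of_int (w j) * coord x j)"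

definition linf :: "nat \<Rightarrow> (nat \<Rightarrow> 'a::linordered_idom) \<Rightarrow> 'a" where
  "linf n w = Max ((\<lambda>j. \<bar>w j\<bar>) ` {..<n})"


section \<open>Polytopes, edges and simplex paths\<close>

definition lattice_polytope :: "nat \<Rightarrow> rvec set \<Rightarrow> bool" where
  "lattice_polytope n Q \<longleftrightarrow> Q \<subseteq> coord_space n \<and> polytope Q \<and>
     (\<forall>v. v extreme_point_of Q \<longrightarrow> (\<forall>j<n. coord v j \<in> \<int>))"

definition box_polytope :: "nat \<Rightarrow> nat \<Rightarrow> rvec set \<Rightarrow> bool" where
  "box_polytope n k Q \<longleftrightarrow> lattice_polytope n Q \<and>
     (\<forall>x\<in>Q. \<forall>j<n. 0 \<le> coord x j \<and> coord x j \<le> real k)"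

(* The library's edge_of needs a Euclidean space (it uses aff_dim).  An edge joining two
   vertices of a polytope is a one-dimensional face, i.e. the segment between them. *)
definition adjacent :: "rvec set \<Rightarrow> rvec \<Rightarrow> rvec \<Rightarrow> bool" where
  "adjacent Q v v' \<longleftrightarrow> v extreme_point_of Q \<and> v' extreme_point_of Q \<and> v \<noteq> v' \<and>
     closed_segment v v' face_of Q"

definition simplex_path :: "rvec set \<Rightarrow> rvec list \<Rightarrow> bool" where
  "simplex_path Q p \<longleftrightarrow> p \<noteq> [] \<and> (\<forall>v\<in>set p. v extreme_point_of Q) \<and>
     successively (adjacent Q) p"

definition maximizes :: "nat \<Rightarrow> ivec \<Rightarrow> rvec set \<Rightarrow> rvec \<Rightarrow> bool" where
  "maximizes n w Q v \<longleftrightarrow> v \<in> Q \<and> (\<forall>x\<in>Q. dotp n w x \<le> dotp n w v)"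

definition polyhedron_of :: "nat \<Rightarrow> nat \<Rightarrow> imat \<Rightarrow> ivec \<Rightarrow> rvec set" where
  "polyhedron_of n m A b =
     {x \<in> coord_space n. \<forall>i<m. dotp n (A i) x \<le> real_of_int (b i)}"

definition max_entry :: "nat \<Rightarrow> nat \<Rightarrow> imat \<Rightarrow> int" where
  "max_entry n m A = Max ((\<lambda>(i, j). \<bar>A i j\<bar>) ` ({..<m} \<times> {..<n}))"


section \<open>Oracle and scaling algorithm\<close>

(* The algorithms are nondeterministic transition relations, so that every admissible answer
   of the oracle (and every admissible choice made by the iterative algorithm) is covered. *)

definition oracle_move :: "nat \<Rightarrow> rvec set \<Rightarrow> ivec \<Rightarrow> rvec \<Rightarrow> rvec \<Rightarrow> bool" where
  "oracle_move n Q w v v' \<longleftrightarrow> adjacent Q v v' \<and> dotp n w v < dotp n w v'"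

definition scaling_depth :: "nat \<Rightarrow> ivec \<Rightarrow> nat" where
  "scaling_depth n w = nat \<lceil>log 2 (real_of_int (linf n w))\<rceil>"

definition scaled_cost :: "nat \<Rightarrow> ivec \<Rightarrow> nat \<Rightarrow> ivec" where
  "scaled_cost n w t = (\<lambda>j. \<lceil>real_of_int (w j) / 2 ^ (scaling_depth n w - t)\<rceil>)"

(* In a state (t, v, p), v is the current vertex of the basic algorithm run with the t-th
   scaled cost, and p lists the vertices visited so far.  A state with
   t = scaling_depth n w + 1 is one in which the scaling algorithm has returned v. *)
inductive scaling_step ::
  "nat \<Rightarrow> rvec set \<Rightarrow> ivec \<Rightarrow> nat \<times> rvec \<times> rvec list \<Rightarrow> nat \<times> rvec \<times> rvec list \<Rightarrow> bool"
  for n :: nat and Q :: "rvec set" and w :: ivec where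
  move: "t \<le> scaling_depth n w \<Longrightarrow> oracle_move n Q (scaled_cost n w t) v v' \<Longrightarrow>
         scaling_step n Q w (t, v, p) (t, v', p @ [v'])"
| optimal: "t \<le> scaling_depth n w \<Longrightarrow> maximizes n (scaled_cost n w t) Q v \<Longrightarrow>
         scaling_step n Q w (t, v, p) (Suc t, v, p)"


section \<open>Iterative algorithm\<close>

definition kernel_rows :: "nat \<Rightarrow> imat \<Rightarrow> nat set \<Rightarrow> rvec set" where
  "kernel_rows n A E = {x \<in> coord_space n. \<forall>i\<in>E. dotp n (A i) x = 0}"

definition orth_proj :: "nat \<Rightarrow> rvec set \<Rightarrow> ivec \<Rightarrow> rvec" where
  "orth_proj n S c = (THE z. z \<in> S \<and>
     (\<forall>s\<in>S. (\<Sum>j<n. (real_of_int (c j) - coord z j) * coord s j) = 0))"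

definition rounded_cost :: "nat \<Rightarrow> nat \<Rightarrow> int \<Rightarrow> rvec \<Rightarrow> ivec" where
  "rounded_cost n k \<alpha> z =
     (\<lambda>j. \<lfloor>real n ^ 3 * real k * real_of_int \<alpha> / linf n (coord z) * coord z j\<rfloor>)"

definition primal_region :: "nat \<Rightarrow> nat \<Rightarrow> imat \<Rightarrow> ivec \<Rightarrow> nat set \<Rightarrow> rvec set" where
  "primal_region n m A b E = {x \<in> coord_space n.
     (\<forall>i\<in>E. dotp n (A i) x = real_of_int (b i)) \<and>
     (\<forall>i\<in>{..<m} - E. dotp n (A i) x \<le> real_of_int (b i))}"

definition dual_feasible ::
  "nat \<Rightarrow> nat \<Rightarrow> imat \<Rightarrow> nat set \<Rightarrow> ivec \<Rightarrow> (nat \<Rightarrow> real) \<Rightarrow> bool" where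
  "dual_feasible n m A E w y \<longleftrightarrow>
     (\<forall>j<n. (\<Sum>i<m. real_of_int (A i j) * y i) = real_of_int (w j)) \<and>
     (\<forall>i\<in>{..<m} - E. 0 \<le> y i)"

definition dual_optimal ::
  "nat \<Rightarrow> nat \<Rightarrow> imat \<Rightarrow> ivec \<Rightarrow> nat set \<Rightarrow> ivec \<Rightarrow> (nat \<Rightarrow> real) \<Rightarrow> bool" where
  "dual_optimal n m A b E w y \<longleftrightarrow> dual_feasible n m A E w y \<and>
     (\<forall>z. dual_feasible n m A E w z \<longrightarrow>
        (\<Sum>i<m. real_of_int (b i) * y i) \<le> (\<Sum>i<m. real_of_int (b i) * z i))"

definition row_in_span :: "nat \<Rightarrow> imat \<Rightarrow> nat set \<Rightarrow> nat \<Rightarrow> bool" where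
  "row_in_span n A E j \<longleftrightarrow>
     (\<exists>r::nat \<Rightarrow> real. \<forall>l<n. real_of_int (A j l) = (\<Sum>i\<in>E. r i * real_of_int (A i l)))"

definition admissible_dual ::
  "nat \<Rightarrow> nat \<Rightarrow> imat \<Rightarrow> ivec \<Rightarrow> nat set \<Rightarrow> ivec \<Rightarrow> (nat \<Rightarrow> real) \<Rightarrow> bool" where
  "admissible_dual n m A b E w y \<longleftrightarrow> dual_optimal n m A b E w y \<and>
     card {i \<in> {..<m}. y i \<noteq> 0} \<le> n \<and>
     (\<forall>j\<in>{..<m} - E. row_in_span n A E j \<longrightarrow> y j = 0)"

(* Step1 E x: at the beginning of Step 1, with current set E and current vertex x.
   Step3 E w t v: in Step 3 with rounded cost w, inside the scaling algorithm with
   counter t at the vertex v.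
   Returned x: the algorithm has returned x. *)
datatype iter_state =
    Step1 "nat set" rvec
  | Step3 "nat set" ivec nat rvec
  | Returned rvec

(* The list in a configuration is the sequence of vertices generated so far. *)
inductive iter_step ::
  "nat \<Rightarrow> nat \<Rightarrow> nat \<Rightarrow> imat \<Rightarrow> ivec \<Rightarrow> ivec \<Rightarrow>
   iter_state \<times> rvec list \<Rightarrow> iter_state \<times> rvec list \<Rightarrow> bool"
  for n :: nat and m :: nat and k :: nat and A :: imat and b :: ivec and c :: ivec where
  stop: "orth_proj n (kernel_rows n A E) c = 0 \<Longrightarrow>
     iter_step n m k A b c (Step1 E x, p) (Returned x, p)"
| round: "z = orth_proj n (kernel_rows n A E) c \<Longrightarrow> z \<noteq> 0 \<Longrightarrow>
     w = rounded_cost n k (max_entry n m A) z \<Longrightarrow>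
     iter_step n m k A b c (Step1 E x, p) (Step3 E w 0 x, p)"
| scale: "scaling_step n (primal_region n m A b E) w (t, v, p) (t', v', p') \<Longrightarrow>
     iter_step n m k A b c (Step3 E w t v, p) (Step3 E w t' v', p')"
| fix_row: "t = Suc (scaling_depth n w) \<Longrightarrow> admissible_dual n m A b E w y \<Longrightarrow>
     h < m \<Longrightarrow> y h > real n * real k \<Longrightarrow> h \<notin> E \<Longrightarrow>
     iter_step n m k A b c (Step3 E w t v, p) (Step1 (insert h E) v, p)"

end

theory Submission
  imports Defs
begin

text \<open>
Every cost vector of the scaling algorithm is twice its predecessor minus a \<open>0/1\<close> vector, so the
previous optimum is within \<open>n k\<close> of the new one; as values at vertices are integers, each stage makes
at most \<open>n k\<close> moves, and there are \<open>O(log (n k \<alpha>))\<close> stages. Fix an integral vertex \<open>xh\<close> of \<open>P\<close> that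
maximizes \<open>c\<close>. A dual value \<open>y h > n k\<close> forces row \<open>h\<close> to be tight at \<open>xh\<close>, because rounding the
projected cost perturbs the difference of two values by at most \<open>n k\<close>. So \<open>xh\<close> stays in the current
face, whose fixed rows are linearly independent, whence at most \<open>n\<close> rows get fixed. For \<open>n \<ge> 2\<close> a
norm estimate yields such a row as long as the projected cost is nonzero; for \<open>n = 1\<close> the algorithm
may halt without one, but then rounding is exact and the current vertex is already optimal.
\<close>

section \<open>Linear algebra of finitely supported sequences\<close>

text \<open>The threshold n k and the factor n^3 k alpha are matched by one estimate. Suppose all
  dual values outside E are at most n k. Pairing the rounded cost with its projection z kills the
  rows of E and leaves at most n rows, each contributing at most n k alpha ||z||_1; undoing the
  rounding adds at most ||z||_1. The unrounded cost pairs with z to n^3 k alpha ||z||_2^2 /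
  ||z||_inf, and ||z||_inf ||z||_1 <= sqrt n ||z||_2^2. With t = n^2 k alpha this gives sqrt n t <=
  t + 1, impossible for n >= 2 because t >= 4. For n = 1 there may be no such row: on [0, 2], given
  by x <= 2 and -x <= 0, with c = 1 the dual value is 2 = n k. The algorithms are transition
  relations, so a configuration could also lack a successor because an oracle answer or a dual
  solution is missing. Hence the existence of improving neighbours and of dual solutions with (i)
  and (ii) has to be proved, and termination needs its own argument by a bounded rank.\<close>

lemma coord_scaleR: "coord (r *\<^sub>R x) j = r * coord x j"
proof -
  have "finite {i. r * coord x i \<noteq> 0}"
    by (rule finite_subset[OF _ finite_lookup[of x]]) auto
  then show ?thesis
    by (simp add: scaleR_poly_mapping_def Abs_poly_mapping_inverse)
qed

lemmas coord_simps = lookup_add lookup_minus coord_scaleR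

lemma coord_space_iff: "x \<in> coord_space n \<longleftrightarrow> (\<forall>j\<ge>n. coord x j = 0)"
  by (auto simp: coord_space_def subset_iff in_keys_iff) (meson not_less)

lemma coord_space_0 [simp]: "0 \<in> coord_space n"
  by (simp add: coord_space_iff)

lemma coord_space_add: "x \<in> coord_space n \<Longrightarrow> y \<in> coord_space n \<Longrightarrow> x + y \<in> coord_space n"
  by (simp add: coord_space_iff coord_simps)

lemma coord_space_diff: "x \<in> coord_space n \<Longrightarrow> y \<in> coord_space n \<Longrightarrow> x - y \<in> coord_space n"
  by (simp add: coord_space_iff coord_simps)

lemma coord_space_scaleR: "x \<in> coord_space n \<Longrightarrow> r *\<^sub>R x \<in> coord_space n"
  by (simp add: coord_space_iff coord_simps)

lemma coord_space_uminus: "x \<in> coord_space n \<Longrightarrow> - x \<in> coord_space n"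
  by (simp add: coord_space_iff)

lemmas coord_space_closed =
  coord_space_add coord_space_diff coord_space_scaleR coord_space_uminus

lemma coord_space_eqI:
  assumes "x \<in> coord_space n" "y \<in> coord_space n" "\<And>j. j < n \<Longrightarrow> coord x j = coord y j"
  shows "x = y"
  using assms by (intro poly_mapping_eqI) (metis coord_space_iff not_less)

text \<open>Projected and unrounded costs have real entries, while \<open>dotp\<close> takes integer
  ones.\<close>

definition rdot :: "nat \<Rightarrow> (nat \<Rightarrow> real) \<Rightarrow> rvec \<Rightarrow> real" where
  "rdot n u x = (\<Sum>j<n. u j * coord x j)"

lemma dotp_eq_rdot: "dotp n w x = rdot n (\<lambda>j. real_of_int (w j)) x"
  by (simp add: dotp_def rdot_def)

lemma linear_rdot: "linear (rdot n u)"
  by (rule linearI)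
    (simp_all add: rdot_def coord_simps algebra_simps sum.distrib sum_distrib_left)

lemma linear_dotp: "linear (dotp n w)"
proof -
  have "dotp n w = rdot n (\<lambda>j. real_of_int (w j))"
    by (simp add: dotp_eq_rdot fun_eq_iff)
  then show ?thesis
    by (simp add: linear_rdot)
qed

lemmas rdot_simps [simp] =
  linear_add[OF linear_rdot] linear_diff[OF linear_rdot] linear_scale[OF linear_rdot, unfolded real_scaleR_def]
  linear_0[OF linear_rdot] linear_neg[OF linear_rdot]

lemmas dotp_simps [simp] =
  linear_add[OF linear_dotp] linear_diff[OF linear_dotp] linear_scale[OF linear_dotp, unfolded real_scaleR_def]
  linear_0[OF linear_dotp] linear_neg[OF linear_dotp]

lemma rdot_single: "j < n \<Longrightarrow> rdot n u (Poly_Mapping.single j 1) = u j"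
  by (simp add: rdot_def lookup_single when_def if_distrib cong: if_cong)

lemma dotp_single: "j < n \<Longrightarrow> dotp n w (Poly_Mapping.single j 1) = real_of_int (w j)"
  by (simp add: dotp_eq_rdot rdot_single)

lemma sum_coord_sq_pos:
  assumes "x \<in> coord_space n" "x \<noteq> 0"
  shows "(\<Sum>j<n. (coord x j)\<^sup>2) > 0"
proof -
  obtain j where j: "j < n" "coord x j \<noteq> 0"
    using coord_space_eqI[OF assms(1) coord_space_0] assms(2) by auto
  then have "0 < (coord x j)\<^sup>2" by simp
  also have "\<dots> \<le> (\<Sum>j<n. (coord x j)\<^sup>2)"
    using j by (intro member_le_sum) auto
  finally show ?thesis .
qed

section \<open>Linear dependence, ratio test, Farkas' lemma, Caratheodory's reduction\<close>

lemma exists_linear_dependency: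
  fixes a :: "'i \<Rightarrow> nat \<Rightarrow> real"
  assumes "finite S" "n < card S"
  shows "\<exists>\<mu>. (\<exists>i\<in>S. \<mu> i \<noteq> 0) \<and> (\<forall>l<n. (\<Sum>i\<in>S. \<mu> i * a i l) = 0)"
  using assms
proof (induction n arbitrary: S a)
  case 0
  then have "S \<noteq> {}" by auto
  then show ?case by (intro exI[of _ "\<lambda>_. 1"]) auto
next
  case (Suc n)
  show ?case
  proof (cases "\<forall>i\<in>S. a i n = 0")
    case True
    obtain \<mu> where "\<exists>i\<in>S. \<mu> i \<noteq> 0" "\<forall>l<n. (\<Sum>i\<in>S. \<mu> i * a i l) = 0"
      using Suc.IH[of S a] Suc.prems by auto
    with True show ?thesis
      by (intro exI[of _ \<mu>]) (auto simp: less_Suc_eq)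
  next
    case False
    \<comment> \<open>Gaussian elimination with pivot \<open>p\<close>: the last entry of all other
      vectors is cleared, and \<open>c\<close> is the compensating coefficient of the pivot.\<close>
    then obtain p where p: "p \<in> S" "a p n \<noteq> 0" by auto
    let ?S = "S - {p}"
    have "n < card ?S" using Suc.prems p by simp
    then obtain \<mu> where \<mu>: "\<exists>i\<in>?S. \<mu> i \<noteq> 0"
        "\<And>l. l < n \<Longrightarrow> (\<Sum>i\<in>?S. \<mu> i * (a i l - a i n / a p n * a p l)) = 0"
      using Suc.IH[of ?S "\<lambda>i l. a i l - a i n / a p n * a p l"] Suc.prems(1) by auto
    define c where "c = - (\<Sum>i\<in>?S. \<mu> i * a i n) / a p n"
    have eq: "(\<Sum>i\<in>S. (\<mu>(p := c)) i * a i l)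
        = (\<Sum>i\<in>?S. \<mu> i * (a i l - a i n / a p n * a p l))" for l
    proof -
      have "(\<Sum>i\<in>S. (\<mu>(p := c)) i * a i l) = c * a p l + (\<Sum>i\<in>?S. \<mu> i * a i l)"
        using p Suc.prems(1) by (simp add: sum.remove[of S p])
      also have "c * a p l = (\<Sum>i\<in>?S. - (\<mu> i * (a i n / a p n * a p l)))"
        by (simp add: c_def sum_negf sum_distrib_right sum_divide_distrib mult.assoc)
      finally show ?thesis
        by (simp add: sum.distrib[symmetric] algebra_simps)
    qed
    have "(\<Sum>i\<in>S. (\<mu>(p := c)) i * a i l) = 0" if "l < Suc n" for l
      using that \<mu>(2) p(2) unfolding eq by (cases "l = n") auto
    moreover have "\<exists>i\<in>S. (\<mu>(p := c)) i \<noteq> 0"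
      using \<mu>(1) by auto
    ultimately show ?thesis by blast
  qed
qed

text \<open>The minimum ratio rule of the simplex method: \<open>s\<close> is the least quotient
  over positive \<open>q i\<close>, and a minimizing index becomes tight. It serves for feasible
  steps, for the far end of an edge and for shrinking supports.\<close>

lemma ratio_test:
  fixes p q :: "'i \<Rightarrow> real"
  assumes "finite I" "i \<in> I" "q i > 0" and nonneg: "\<And>i. i \<in> I \<Longrightarrow> p i \<ge> 0"
  obtains s i where "s \<ge> 0" "\<And>i. i \<in> I \<Longrightarrow> s * q i \<le> p i" "i \<in> I" "q i > 0" "s * q i = p i"
proof -
  define R where "R = (\<lambda>i. p i / q i) ` {i \<in> I. q i > 0}"
  define s where "s = Min R"
  have R: "finite R" "R \<noteq> {}"
    using assms by (auto simp: R_def)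
  have le: "s \<le> p i / q i" if "i \<in> I" "q i > 0" for i
    unfolding s_def using that by (intro Min_le[OF R(1)]) (auto simp: R_def)
  have "s \<in> R"
    unfolding s_def by (rule Min_in[OF R])
  then obtain i where i: "i \<in> I" "q i > 0" "s = p i / q i"
    by (auto simp: R_def)
  have s0: "s \<ge> 0"
    using i nonneg by simp
  have "s * q i \<le> p i" if "i \<in> I" for i
  proof (cases "q i > 0")
    case True
    then show ?thesis using le[OF that] by (simp add: pos_le_divide_eq)
  next
    case False
    then have "s * q i \<le> 0" using s0 by (intro mult_nonneg_nonpos) auto
    then show ?thesis using nonneg[OF that] by simp
  qed
  then show thesis
    using i s0 that[of s i] by simp
qed

text \<open>Bartl's induction: if dropping the constraint \<open>e\<close> breaks the implication at \<open>u\<close>, subtract from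
  all other functionals the multiple of \<open>f e\<close> that makes them vanish at \<open>u\<close>.\<close>

lemma farkas:
  fixes f :: "'i \<Rightarrow> 'v::real_vector \<Rightarrow> real"
  assumes "finite I" "\<And>i. i \<in> I \<Longrightarrow> linear (f i)" "linear g"
    and "\<And>x. (\<And>i. i \<in> I \<Longrightarrow> f i x \<le> 0) \<Longrightarrow> (\<And>i. i \<in> I \<inter> E \<Longrightarrow> f i x = 0) \<Longrightarrow> g x \<le> 0"
  shows "\<exists>y. (\<forall>i\<in>I - E. 0 \<le> y i) \<and> (\<forall>x. g x = (\<Sum>i\<in>I. y i * f i x))"
  using assms
proof (induction I arbitrary: f g rule: finite_induct)
  case empty
  have "g x = 0" for x
    using empty.prems(3)[of x] empty.prems(3)[of "- x"] linear_neg[OF empty.prems(2)] by simp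
  then show ?case by simp
next
  case (insert e I)
  note lf = linear_add linear_diff linear_scale
  have le: "linear (f e)" and lI: "\<And>i. i \<in> I \<Longrightarrow> linear (f i)" and lg: "linear g"
    using insert.prems by auto
  show ?case
  proof (cases "\<forall>x. (\<forall>i\<in>I. f i x \<le> 0) \<longrightarrow> (\<forall>i\<in>I \<inter> E. f i x = 0) \<longrightarrow> g x \<le> 0")
    case True
    then obtain y where y: "\<forall>i\<in>I - E. 0 \<le> y i" "\<And>x. g x = (\<Sum>i\<in>I. y i * f i x)"
      using insert.IH[of f g] lI lg by blast
    have "g x = (\<Sum>i\<in>insert e I. (y(e := 0)) i * f i x)" for x
    proof -
      have "(\<Sum>i\<in>I. (y(e := 0)) i * f i x) = (\<Sum>i\<in>I. y i * f i x)"
        using insert.hyps by (intro sum.cong) auto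
      then show ?thesis using insert.hyps y(2) by simp
    qed
    then show ?thesis using y(1) by (intro exI[of _ "y(e := 0)"]) auto
  next
    case False
    then obtain u where u: "\<And>i. i \<in> I \<Longrightarrow> f i u \<le> 0" "\<And>i. i \<in> I \<inter> E \<Longrightarrow> f i u = 0" "g u > 0"
      by (auto simp: not_le)
    \<comment> \<open>As \<open>g u > 0\<close>, the constraint of \<open>e\<close> must be the one
      that \<open>u\<close> violates.\<close>
    have fe: "f e u \<noteq> 0" "e \<notin> E \<Longrightarrow> f e u > 0"
      using insert.prems(3)[of u] u by (force, force)
    let ?f = "\<lambda>i x. f i x - f i u / f e u * f e x"
    let ?g = "\<lambda>x. g x - g u / f e u * f e x"
    have lf': "linear (\<lambda>x. h x - c * f e x)" if "linear h" for h c
      by (rule linearI) (simp_all add: lf[OF that] lf[OF le] algebra_simps)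
    have "?g x \<le> 0" if "\<And>i. i \<in> I \<Longrightarrow> ?f i x \<le> 0" "\<And>i. i \<in> I \<inter> E \<Longrightarrow> ?f i x = 0" for x
    proof -
      \<comment> \<open>Sliding along \<open>u\<close> into the kernel of \<open>f e\<close>
        satisfies the constraint of \<open>e\<close> with equality, whether or not \<open>e\<close>
        lies in \<open>E\<close>.\<close>
      let ?x = "x - (f e x / f e u) *\<^sub>R u"
      have h: "h ?x = h x - h u / f e u * f e x" if "linear h" for h
        by (simp add: lf[OF that])
      have "f e ?x = 0" using h[OF le] fe by simp
      moreover have "f i ?x = ?f i x" if "i \<in> I" for i using h[OF lI[OF that]] .
      ultimately have "g ?x \<le> 0" using that by (intro insert.prems(3)) auto
      then show ?thesis using h[OF lg] by simp
    qed
    then obtain y where y: "\<forall>i\<in>I - E. 0 \<le> y i" "\<And>x. ?g x = (\<Sum>i\<in>I. y i * ?f i x)"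
      using insert.IH[of ?f ?g] lf' lI lg by blast
    \<comment> \<open>Collects all multiples of \<open>f e\<close>. For \<open>e\<close> outside
      \<open>E\<close> it is nonnegative because the subtracted sum is at most 0.\<close>
    define r where "r = (g u - (\<Sum>i\<in>I. y i * f i u)) / f e u"
    have "r \<ge> 0" if "e \<notin> E"
    proof -
      have "y i * f i u \<le> 0" if "i \<in> I" for i
        using u(1,2)[of i] y(1) that
        by (cases "i \<in> E") (auto simp: mult_nonneg_nonpos)
      then have "(\<Sum>i\<in>I. y i * f i u) \<le> 0" by (rule sum_nonpos)
      then show ?thesis using u(3) fe(2)[OF that] by (simp add: r_def)
    qed
    moreover have "g x = (\<Sum>i\<in>insert e I. (y(e := r)) i * f i x)" for x
    proof -
      have "g x = g u / f e u * f e x + (\<Sum>i\<in>I. y i * ?f i x)"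
        using y(2)[of x] by simp
      also have "(\<Sum>i\<in>I. y i * ?f i x)
          = (\<Sum>i\<in>I. y i * f i x) - (\<Sum>i\<in>I. y i * f i u) / f e u * f e x"
        by (simp add: algebra_simps sum_subtractf sum_distrib_left sum_distrib_right sum_divide_distrib)
      also have "g u / f e u * f e x + \<dots> = r * f e x + (\<Sum>i\<in>I. y i * f i x)"
        by (simp add: r_def diff_divide_distrib algebra_simps)
      also have "(\<Sum>i\<in>I. y i * f i x) = (\<Sum>i\<in>I. (y(e := r)) i * f i x)"
        using insert.hyps by (intro sum.cong) auto
      finally show ?thesis using insert.hyps by simp
    qed
    ultimately show ?thesis using y(1) by (intro exI[of _ "y(e := r)"]) auto
  qed
qed

text \<open>A combination with the fewest nonzero coefficients uses linearly independent vectors.\<close>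

lemma conic_caratheodory:
  fixes a :: "'i \<Rightarrow> nat \<Rightarrow> real"
  assumes "finite I" "\<forall>i\<in>I - E. 0 \<le> y i" "\<And>l. l < n \<Longrightarrow> (\<Sum>i\<in>I. y i * a i l) = w l"
  shows "\<exists>y. (\<forall>i\<in>I - E. 0 \<le> y i) \<and> (\<forall>l<n. (\<Sum>i\<in>I. y i * a i l) = w l)
    \<and> card {i\<in>I. y i \<noteq> 0} \<le> n"
proof -
  define good where "good y \<longleftrightarrow> (\<forall>i\<in>I - E. 0 \<le> y i) \<and> (\<forall>l<n. (\<Sum>i\<in>I. y i * a i l) = w l)" for y
  define supp where "supp y = {i\<in>I. y i \<noteq> 0}" for y :: "'i \<Rightarrow> real"
  have "good y" using assms by (simp add: good_def)
  then obtain y where y: "good y" and min: "\<And>z. good z \<Longrightarrow> card (supp y) \<le> card (supp z)"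
    using exists_least_iff[of "\<lambda>c. \<exists>z. good z \<and> card (supp z) = c"] by (metis not_less)
  have "card (supp y) \<le> n"
  proof (rule ccontr)
    assume "\<not> card (supp y) \<le> n"
    then obtain \<mu> where \<mu>: "\<exists>i\<in>supp y. \<mu> i \<noteq> 0" "\<And>l. l < n \<Longrightarrow> (\<Sum>i\<in>supp y. \<mu> i * a i l) = 0"
      using exists_linear_dependency[of "supp y" n a] assms(1) by (auto simp: supp_def)
    have fin: "finite (supp y)" using assms(1) by (simp add: supp_def)
    \<comment> \<open>Follow the dependency until a coefficient vanishes. If it changes coefficients
      outside \<open>E\<close>, their signs limit the step; otherwise a coefficient in
      \<open>E\<close> can be cancelled outright.\<close>
    have "\<exists>s i. i \<in> supp y \<and> y i + s * \<mu> i = 0 \<and> (\<forall>i\<in>supp y - E. 0 \<le> y i + s * \<mu> i)"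
    proof (cases "\<exists>i\<in>supp y - E. \<mu> i \<noteq> 0")
      case True
      then obtain i where i: "i \<in> supp y - E" "\<mu> i \<noteq> 0" by blast
      \<comment> \<open>This sign makes coefficient \<open>i\<close> decrease, so the ratio test has
        a blocking index.\<close>
      define \<sigma> where "\<sigma> = - sgn (\<mu> i)"
      have "\<sigma> * \<mu> i < 0" using i by (auto simp: \<sigma>_def sgn_if)
      then have pos: "- (\<sigma> * \<mu> i) > 0" by simp
      have "finite (supp y - E)" "\<And>i. i \<in> supp y - E \<Longrightarrow> 0 \<le> y i"
        using fin y by (auto simp: good_def supp_def)
      from ratio_test[of "supp y - E" i "\<lambda>i. - (\<sigma> * \<mu> i)" y, OF this(1) i(1) pos this(2)]
      obtain s j where s: "\<And>i. i \<in> supp y - E \<Longrightarrow> s * - (\<sigma> * \<mu> i) \<le> y i"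
          "j \<in> supp y - E" "s * - (\<sigma> * \<mu> j) = y j" by metis
      have "0 \<le> y i + s * \<sigma> * \<mu> i" if "i \<in> supp y - E" for i
        using s(1)[OF that] by (simp add: algebra_simps)
      then show ?thesis
        using s(2,3) by (intro exI[of _ "s * \<sigma>"] exI[of _ j]) (simp add: algebra_simps)
    next
      case False
      then obtain i where i: "i \<in> supp y" "\<mu> i \<noteq> 0" using \<mu>(1) by blast
      then show ?thesis
        using False y
        by (intro exI[of _ "- y i / \<mu> i"] exI[of _ i]) (auto simp: good_def supp_def)
    qed
    then obtain s i where s: "i \<in> supp y" "y i + s * \<mu> i = 0"
        "\<And>i. i \<in> supp y - E \<Longrightarrow> 0 \<le> y i + s * \<mu> i" by blast
    define z where "z i = (if i \<in> supp y then y i + s * \<mu> i else 0)" for i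
    have "(\<Sum>i\<in>I. z i * a i l) = w l" if "l < n" for l
    proof -
      have sub: "supp y \<subseteq> I" by (auto simp: supp_def)
      have "(\<Sum>i\<in>I. z i * a i l) = (\<Sum>i\<in>supp y. z i * a i l)"
        using sub assms(1) by (intro sum.mono_neutral_right) (auto simp: z_def)
      also have "\<dots> = (\<Sum>i\<in>supp y. y i * a i l) + s * (\<Sum>i\<in>supp y. \<mu> i * a i l)"
        by (simp add: z_def algebra_simps sum.distrib sum_distrib_left)
      also have "(\<Sum>i\<in>supp y. y i * a i l) = (\<Sum>i\<in>I. y i * a i l)"
        using sub assms(1) by (intro sum.mono_neutral_left) (auto simp: supp_def)
      finally show ?thesis using \<mu>(2) y that by (simp add: good_def)
    qed
    moreover have "\<forall>i\<in>I - E. 0 \<le> z i" using s(3) by (auto simp: z_def)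
    ultimately have "good z" by (simp add: good_def)
    moreover have "supp z \<subset> supp y"
      using s(1,2) by (auto simp: supp_def z_def)
    ultimately show False using min psubset_card_mono[OF fin] by (meson not_less)
  qed
  with y show ?thesis unfolding good_def supp_def by blast
qed


section \<open>Faces, edges and improving moves\<close>

locale lattice_lp =
  fixes n m k :: nat and A :: imat and b :: ivec
  assumes box: "box_polytope n k (polyhedron_of n m A b)"
begin

abbreviation P where "P \<equiv> polyhedron_of n m A b"
abbreviation F where "F \<equiv> primal_region n m A b"

lemma P_iff: "x \<in> P \<longleftrightarrow> x \<in> coord_space n \<and> (\<forall>i<m. dotp n (A i) x \<le> real_of_int (b i))"
  by (simp add: polyhedron_of_def)

lemma F_iff: "E \<subseteq> {..<m} \<Longrightarrow> x \<in> F E \<longleftrightarrow> x \<in> P \<and> (\<forall>i\<in>E. dotp n (A i) x = real_of_int (b i))"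
  by (fastforce simp: P_iff primal_region_def)

lemma coord_bounds: "x \<in> P \<Longrightarrow> j < n \<Longrightarrow> 0 \<le> coord x j \<and> coord x j \<le> real k"
  using box by (auto simp: box_polytope_def)

lemma coord_diff_bound: "x \<in> P \<Longrightarrow> x' \<in> P \<Longrightarrow> j < n \<Longrightarrow> \<bar>coord x j - coord x' j\<bar> \<le> real k"
  using coord_bounds[of x j] coord_bounds[of x' j] by linarith

lemma extreme_point_Ints: "v extreme_point_of P \<Longrightarrow> j < n \<Longrightarrow> coord v j \<in> \<int>"
  using box by (auto simp: box_polytope_def lattice_polytope_def)

lemma dotp_Ints: "(\<And>j. j < n \<Longrightarrow> coord x j \<in> \<int>) \<Longrightarrow> dotp n w x \<in> \<int>"
  unfolding dotp_def by (intro Ints_sum Ints_mult) auto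

lemma convex_P: "convex P"
proof (rule convexI)
  fix x y :: rvec and u v :: real
  assume xy: "x \<in> P" "y \<in> P" and uv: "0 \<le> u" "0 \<le> v" "u + v = 1"
  show "u *\<^sub>R x + v *\<^sub>R y \<in> P"
    using xy uv by (auto simp: P_iff intro!: coord_space_closed convex_bound_le)
qed

text \<open>A slack that vanishes inside a segment vanishes at both ends. Being a face is what turns
  vertices and edges of \<open>F E\<close> into vertices and edges of \<open>P\<close>.\<close>

lemma F_face_of_P:
  assumes "E \<subseteq> {..<m}"
  shows "F E face_of P"
  unfolding face_of_def
proof (intro conjI ballI impI)
  show "F E \<subseteq> P" using assms by (auto simp: F_iff)
  show "convex (F E)"
  proof (rule convexI)
    fix x y :: rvec and u v :: real
    assume xy: "x \<in> F E" "y \<in> F E" and uv: "0 \<le> u" "0 \<le> v" "u + v = 1"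
    have "dotp n (A i) (u *\<^sub>R x + v *\<^sub>R y) = real_of_int (b i)" if "i \<in> E" for i
      using xy uv that assms by (simp add: F_iff flip: distrib_right)
    then show "u *\<^sub>R x + v *\<^sub>R y \<in> F E"
      using convexD[OF convex_P _ _ uv] xy assms by (simp add: F_iff)
  qed
next
  fix x y z
  assume x: "x \<in> P" and y: "y \<in> P" and z: "z \<in> F E" and seg: "z \<in> open_segment x y"
  then obtain u where u: "0 < u" "u < 1" and zeq: "z = (1 - u) *\<^sub>R x + u *\<^sub>R y"
    by (auto simp: in_segment)
  have "dotp n (A i) x = real_of_int (b i) \<and> dotp n (A i) y = real_of_int (b i)" if "i \<in> E" for i
  proof -
    let ?p = "(1 - u) * (real_of_int (b i) - dotp n (A i) x)"
    let ?q = "u * (real_of_int (b i) - dotp n (A i) y)"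
    have "i < m" using that assms by auto
    then have "?p \<ge> 0" "?q \<ge> 0" using x y u by (auto simp: P_iff)
    moreover have "?p + ?q = 0"
      using z that assms by (simp add: F_iff zeq algebra_simps)
    ultimately have "?p = 0" "?q = 0" by linarith+
    then show ?thesis using u by auto
  qed
  then show "x \<in> F E" "y \<in> F E"
    using x y assms by (auto simp: F_iff)
qed

lemma F_subset_P: "E \<subseteq> {..<m} \<Longrightarrow> F E \<subseteq> P"
  using F_face_of_P face_of_imp_subset by blast

lemma extreme_point_F: "E \<subseteq> {..<m} \<Longrightarrow> v extreme_point_of F E \<longleftrightarrow> v extreme_point_of P \<and> v \<in> F E"
  by (rule extreme_point_of_face[OF F_face_of_P])

lemma adjacent_F_imp_P: "E \<subseteq> {..<m} \<Longrightarrow> adjacent (F E) v v' \<Longrightarrow> adjacent P v v'"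
  using F_face_of_P[of E] by (auto simp: adjacent_def extreme_point_F intro: face_of_trans)

definition tight :: "rvec \<Rightarrow> nat set" where
  "tight v = {i. i < m \<and> dotp n (A i) v = real_of_int (b i)}"

lemma finite_tight [simp]: "finite (tight v)"
  by (simp add: tight_def)

text \<open>Only tight rows restrict a direction locally: a blocking row has positive slack, so the
  ratio test gives a positive step.\<close>

lemma feasible_step:
  assumes "E \<subseteq> {..<m}" "v \<in> F E" "d \<in> coord_space n"
    "\<And>i. i \<in> E \<Longrightarrow> dotp n (A i) d = 0" "\<And>i. i \<in> tight v \<Longrightarrow> dotp n (A i) d \<le> 0"
  obtains s where "s > 0" "v + s *\<^sub>R d \<in> F E"
proof (cases "\<exists>i<m. dotp n (A i) d > 0")
  case True
  then obtain i where i: "i \<in> {..<m}" "dotp n (A i) d > 0" by blast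
  have slack: "0 \<le> real_of_int (b i) - dotp n (A i) v" if "i \<in> {..<m}" for i
    using that assms(1,2) by (auto simp: F_iff P_iff)
  obtain s i where s: "s \<ge> 0" "\<And>i. i \<in> {..<m} \<Longrightarrow> s * dotp n (A i) d \<le> real_of_int (b i) - dotp n (A i) v"
      and i: "i \<in> {..<m}" "dotp n (A i) d > 0" "s * dotp n (A i) d = real_of_int (b i) - dotp n (A i) v"
    using ratio_test[of "{..<m}" i "\<lambda>i. dotp n (A i) d"
        "\<lambda>i. real_of_int (b i) - dotp n (A i) v", OF _ i slack] by blast
  have "i \<notin> tight v" using i(2) assms(5) by fastforce
  then have "s \<noteq> 0" using i by (auto simp: tight_def)
  then show thesis
    using s assms
    by (intro that[of s]) (force simp: F_iff P_iff intro: coord_space_closed)+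
next
  case False
  have "dotp n (A i) (v + d) \<le> real_of_int (b i)" if "i < m" for i
  proof -
    have "dotp n (A i) d \<le> 0" using False that by (meson not_less)
    moreover have "dotp n (A i) v \<le> real_of_int (b i)"
      using assms(1,2) that by (simp add: F_iff P_iff)
    ultimately show ?thesis by simp
  qed
  then show thesis
    using assms by (intro that[of 1]) (auto simp: F_iff P_iff intro: coord_space_closed)
qed

text \<open>Otherwise \<open>v\<close> could move along both \<open>e\<close> and \<open>- e\<close>
  and would lie inside a segment of the face.\<close>

lemma tight_kernel_trivial:
  assumes E: "E \<subseteq> {..<m}" and v: "v extreme_point_of F E"
    and e: "e \<in> coord_space n" "\<And>i. i \<in> tight v \<Longrightarrow> dotp n (A i) e = 0"
  shows "e = 0"
proof (rule ccontr)
  assume "e \<noteq> 0"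
  have vF: "v \<in> F E" using v by (simp add: extreme_point_of_def)
  then have "E \<subseteq> tight v" using E by (auto simp: tight_def F_iff)
  then have eE: "dotp n (A i) e = 0" if "i \<in> E" for i using that e(2) by blast
  obtain s where s: "s > 0" "v + s *\<^sub>R e \<in> F E"
    using feasible_step[OF E vF e(1)] eE e(2) by (metis order_refl)
  have "dotp n (A i) (- e) = 0" if "i \<in> E" for i using eE[OF that] by simp
  moreover have "dotp n (A i) (- e) \<le> 0" if "i \<in> tight v" for i using e(2)[OF that] by simp
  ultimately obtain r where r: "r > 0" "v + r *\<^sub>R (- e) \<in> F E"
    using feasible_step[OF E vF coord_space_uminus[OF e(1)]] by blast
  have "v \<in> open_segment (v + s *\<^sub>R e) (v + r *\<^sub>R (- e))"
    unfolding in_segment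
  \<comment> \<open>This weight balances the displacements \<open>s\<close> and
    \<open>- r\<close>.\<close>
  proof (intro conjI exI[of _ "s / (s + r)"])
    show "v + s *\<^sub>R e \<noteq> v + r *\<^sub>R (- e)"
    proof
      assume "v + s *\<^sub>R e = v + r *\<^sub>R (- e)"
      then have "(s + r) *\<^sub>R e = 0" by (simp add: scaleR_add_left)
      then show False using \<open>e \<noteq> 0\<close> s r by simp
    qed
    have "(1 - s / (s + r)) * s = s / (s + r) * r"
      using s r by (simp add: field_simps)
    then have "((1 - s / (s + r)) * s) *\<^sub>R e = (s / (s + r) * r) *\<^sub>R e"
      by (rule arg_cong)
    then show "v = (1 - s / (s + r)) *\<^sub>R (v + s *\<^sub>R e) + (s / (s + r)) *\<^sub>R (v + r *\<^sub>R (- e))"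
      by (simp only: scaleR_scaleR[symmetric] scaleR_add_right scaleR_minus_right)
        (simp add: scaleR_left_diff_distrib)
  qed (use s r in auto)
  then show False
    using v s r unfolding extreme_point_of_def by blast
qed

text \<open>An improving direction with as many tight constraints as possible spans an extreme ray of the
  cone of feasible directions, and the segment along it is an edge.\<close>

lemma improving_neighbour:
  assumes E: "E \<subseteq> {..<m}" and v: "v extreme_point_of F E"
    and u: "u \<in> F E" "dotp n w v < dotp n w u"
  obtains v' where "oracle_move n (F E) w v v'"
proof -
  let ?a = "\<lambda>i. dotp n (A i)"
  have vF: "v \<in> F E" using v by (simp add: extreme_point_of_def)
  then have ET: "E \<subseteq> tight v" using E by (auto simp: tight_def F_iff)
  define D where "D d \<longleftrightarrow> d \<in> coord_space n \<and> (\<forall>i\<in>E. ?a i d = 0) \<and> (\<forall>i\<in>tight v. ?a i d \<le> 0)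
      \<and> dotp n w d > 0" for d
  define J where "J d = {i \<in> tight v. ?a i d = 0}" for d
  have finJ: "finite (J d)" for d by (simp add: J_def)
  have "D (u - v)"
    using u vF E by (auto simp: D_def F_iff P_iff tight_def intro: coord_space_closed)
  moreover have "\<forall>d. D d \<longrightarrow> card (J d) < Suc (card (tight v))"
    by (auto simp: J_def less_Suc_eq_le intro: card_mono)
  ultimately obtain d where d: "D d" and max: "\<And>d'. D d' \<Longrightarrow> card (J d') \<le> card (J d)"
    using Lattices_Big.ex_has_greatest_nat[of D "u - v" "\<lambda>d. card (J d)"] by blast
  have d': "d \<in> coord_space n" "\<And>i. i \<in> E \<Longrightarrow> ?a i d = 0" "\<And>i. i \<in> tight v \<Longrightarrow> ?a i d \<le> 0"
      "dotp n w d > 0"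
    using d by (auto simp: D_def)
  have EJ: "E \<subseteq> J d" and Jm: "J d \<subseteq> {..<m}"
    using ET d'(2) by (auto simp: J_def tight_def)

  \<comment> \<open>If \<open>e\<close> could leave the cone, adding it to \<open>d\<close> up to
    the first blocking row would keep the value and the rows of \<open>J d\<close> and gain a row,
    against maximality.\<close>
  have no_exit: False
    if e: "e \<in> coord_space n" "\<And>i. i \<in> J d \<Longrightarrow> ?a i e = 0" "dotp n w e = 0"
      and i: "i \<in> tight v" "?a i e > 0" for e i
  proof -
    have slack: "0 \<le> - ?a i d" if "i \<in> tight v" for i using d'(3)[OF that] by simp
    from ratio_test[of "tight v" i "\<lambda>i. ?a i e" "\<lambda>i. - ?a i d", OF finite_tight i slack]
    obtain s i where s: "s \<ge> 0" "\<And>i. i \<in> tight v \<Longrightarrow> s * ?a i e \<le> - ?a i d"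
        "i \<in> tight v" "?a i e > 0" "s * ?a i e = - ?a i d" by blast
    have "D (d + s *\<^sub>R e)"
      using d' e s(2) EJ by (force simp: D_def intro: coord_space_closed)
    then have "card (J (d + s *\<^sub>R e)) \<le> card (J d)" by (rule max)
    moreover have "J d \<subset> J (d + s *\<^sub>R e)"
    proof
      show "J d \<subseteq> J (d + s *\<^sub>R e)" using e(2) by (auto simp: J_def)
      have "i \<in> J (d + s *\<^sub>R e)" "i \<notin> J d" using s e(2)[of i] by (auto simp: J_def)
      then show "J d \<noteq> J (d + s *\<^sub>R e)" by blast
    qed
    ultimately show False using psubset_card_mono[OF finJ] by (meson not_less)
  qed
  have line: "\<exists>r. e = r *\<^sub>R d" if e: "e \<in> coord_space n" "\<And>i. i \<in> J d \<Longrightarrow> ?a i e = 0" for e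
  proof -
    \<comment> \<open>This multiple cancels the value of \<open>e\<close>. Then neither the rest nor
      its negative can increase a tight row, so the rest is 0 because \<open>v\<close> is a
      vertex.\<close>
    define r where "r = dotp n w e / dotp n w d"
    let ?e = "e - r *\<^sub>R d"
    have e0: "?e \<in> coord_space n" "dotp n w ?e = 0" "\<And>i. i \<in> J d \<Longrightarrow> ?a i ?e = 0"
      using e d' by (auto simp: r_def J_def intro: coord_space_closed)
    have "?a i ?e = 0" if "i \<in> tight v" for i
    proof (rule ccontr)
      assume "?a i ?e \<noteq> 0"
      then consider "?a i ?e > 0" | "?a i (- ?e) > 0"
        unfolding linear_neg[OF linear_dotp] by linarith
      then show False
      proof cases
        case 1
        then show False using no_exit[OF e0(1) e0(3) e0(2) that] by blast
      next
        case 2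
        have "?a j (- ?e) = 0" if "j \<in> J d" for j
          using e0(3)[OF that] unfolding linear_neg[OF linear_dotp] by simp
        moreover have "dotp n w (- ?e) = 0"
          using e0(2) unfolding linear_neg[OF linear_dotp] by simp
        ultimately show False
          using no_exit[OF coord_space_uminus[OF e0(1)] _ _ that 2] by blast
      qed
    qed
    then have "?e = 0" by (rule tight_kernel_trivial[OF E v e0(1)])
    then show ?thesis by auto
  qed

  \<comment> \<open>Without a blocking row the whole ray would stay in the box.\<close>
  have "\<exists>i<m. ?a i d > 0"
  proof (rule ccontr)
    assume "\<not> (\<exists>i<m. ?a i d > 0)"
    then have le: "?a i d \<le> 0" if "i < m" for i
      using that by (meson not_less)
    have inP: "v + t *\<^sub>R d \<in> P" if "t \<ge> 0" for t
    proof -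
      have "?a i v + t * ?a i d \<le> real_of_int (b i)" if "i < m" for i
      proof -
        have "t * ?a i d \<le> 0" using \<open>t \<ge> 0\<close> le[OF that] by (rule mult_nonneg_nonpos)
        moreover have "?a i v \<le> real_of_int (b i)" using vF E that by (simp add: F_iff P_iff)
        ultimately show ?thesis by simp
      qed
      then show ?thesis using vF E d'(1) by (auto simp: F_iff P_iff intro: coord_space_closed)
    qed
    have "d \<noteq> 0" using d'(4) by auto
    then obtain j where j: "j < n" "coord d j \<noteq> 0"
      using coord_space_eqI[OF d'(1) coord_space_0] by auto
    \<comment> \<open>Long enough to shift coordinate \<open>j\<close> by
      \<open>k + 1\<close>.\<close>
    define t where "t = (real k + 1) / \<bar>coord d j\<bar>"
    have "t \<ge> 0" by (simp add: t_def)
    then have "\<bar>coord (v + t *\<^sub>R d) j - coord v j\<bar> \<le> real k"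
      using inP[of t] inP[of 0] j(1) by (intro coord_diff_bound) auto
    then have "\<bar>t * coord d j\<bar> \<le> real k" by (simp add: coord_simps)
    moreover have "\<bar>t * coord d j\<bar> = real k + 1"
      using j by (simp add: t_def abs_mult)
    ultimately show False by simp
  qed
  then obtain i where i: "i \<in> {..<m}" "?a i d > 0" by blast
  have slack: "0 \<le> real_of_int (b i) - ?a i v" if "i \<in> {..<m}" for i
    using that vF E by (auto simp: F_iff P_iff)
  from ratio_test[of "{..<m}" i "\<lambda>i. ?a i d" "\<lambda>i. real_of_int (b i) - ?a i v",
      OF finite_lessThan i slack]
  obtain s h where s: "s \<ge> 0" "\<And>i. i \<in> {..<m} \<Longrightarrow> s * ?a i d \<le> real_of_int (b i) - ?a i v"
      and h: "h \<in> {..<m}" "?a h d > 0" "s * ?a h d = real_of_int (b h) - ?a h v" by blast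
  have "h \<notin> tight v" using h(2) d'(3)[of h] by auto
  then have "s > 0" using h s(1) by (auto simp: tight_def less_le)
  define v' where "v' = v + s *\<^sub>R d"
  have tightJ: "?a i v = real_of_int (b i)" "?a i d = 0" if "i \<in> J d" for i
    using that by (auto simp: J_def tight_def)
  have v'P: "v' \<in> P"
    using s(2) vF E d'(1) by (force simp: v'_def F_iff P_iff intro: coord_space_closed)
  have v'J: "v' \<in> F (J d)"
    using v'P tightJ Jm by (simp add: F_iff v'_def)
  have vJ: "v \<in> F (J d)"
    using vF E tightJ Jm by (simp add: F_iff)
  have JE: "F (J d) \<subseteq> F E" using EJ F_iff[OF E] F_iff[OF Jm] by blast
  have on_edge: "\<exists>r. 0 \<le> r \<and> r \<le> s \<and> x = v + r *\<^sub>R d" if x: "x \<in> F (J d)" for x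
  proof -
    have "x - v \<in> coord_space n" "\<And>i. i \<in> J d \<Longrightarrow> ?a i (x - v) = 0"
      using x vJ Jm by (auto simp: F_iff P_iff intro: coord_space_closed)
    then obtain r where r: "x - v = r *\<^sub>R d" using line by blast
    then have xr: "x = v + r *\<^sub>R d" by (simp add: algebra_simps)
    have "?a h x \<le> real_of_int (b h)" using x Jm h(1) by (auto simp: F_iff P_iff)
    then have "r * ?a h d \<le> s * ?a h d" using h(3) by (simp add: xr)
    then have "r \<le> s" using h(2) by simp
    \<comment> \<open>A point behind \<open>v\<close> would place \<open>v\<close> inside a segment,
      as \<open>v'\<close> lies ahead of it.\<close>
    moreover have "0 \<le> r"
    proof (rule ccontr)
      assume "\<not> 0 \<le> r"
      then have r0: "r < 0" by simp
      have "v \<in> open_segment x v'"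
        unfolding in_segment
      proof (intro conjI exI[of _ "- r / (s - r)"])
        have "d \<noteq> 0" using d'(4) by auto
        then show "x \<noteq> v'" using r0 \<open>s > 0\<close> by (simp add: xr v'_def)
        have "(1 - (- r / (s - r))) * r + (- r / (s - r)) * s = 0"
          using r0 \<open>s > 0\<close> by (simp add: field_simps)
        then have "((1 - (- r / (s - r))) * r + (- r / (s - r)) * s) *\<^sub>R d = 0" by simp
        then show "v = (1 - (- r / (s - r))) *\<^sub>R x + (- r / (s - r)) *\<^sub>R v'"
          by (simp add: xr v'_def scaleR_add_right scaleR_add_left scaleR_left_diff_distrib)
      qed (use r0 \<open>s > 0\<close> in \<open>auto simp: field_simps\<close>)
      then show False using v JE x v'J unfolding extreme_point_of_def by blast
    qed
    ultimately show ?thesis using xr by blast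
  qed
  have "F (J d) = closed_segment v v'"
  proof
    show "closed_segment v v' \<subseteq> F (J d)"
      using vJ v'J F_face_of_P[OF Jm] by (intro closed_segment_subset) (auto simp: face_of_def)
    show "F (J d) \<subseteq> closed_segment v v'"
    proof
      fix x assume "x \<in> F (J d)"
      then obtain r where r: "0 \<le> r" "r \<le> s" "x = v + r *\<^sub>R d" using on_edge by blast
      have "x = (1 - r / s) *\<^sub>R v + (r / s) *\<^sub>R v'"
        using \<open>s > 0\<close> by (simp add: r(3) v'_def scaleR_left_diff_distrib scaleR_add_right)
      then show "x \<in> closed_segment v v'"
        using r \<open>s > 0\<close> by (auto simp: in_segment intro!: exI[of _ "r / s"])
    qed
  qed
  moreover have faceJ: "F (J d) face_of F E"
    using F_face_of_P[OF Jm] JE F_subset_P[OF E] by (rule face_of_subset)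
  moreover have "v' extreme_point_of F E"
  proof -
    \<comment> \<open>Fixing the blocking row as well cuts the edge down to the single point
      \<open>v'\<close>, which is therefore a face.\<close>
    let ?J = "insert h (J d)"
    have Jm': "?J \<subseteq> {..<m}" using Jm h(1) by auto
    have hv': "?a h v' = real_of_int (b h)" using h(3) by (simp add: v'_def)
    have "x = v'" if "x \<in> F ?J" for x
    proof -
      have "x \<in> F (J d)" "?a h x = real_of_int (b h)" using that Jm Jm' by (auto simp: F_iff)
      with on_edge obtain r where x: "x = v + r *\<^sub>R d" by blast
      have "?a h x = ?a h v'" using \<open>?a h x = real_of_int (b h)\<close> hv' by simp
      then have "r * ?a h d = s * ?a h d" unfolding x v'_def dotp_simps by linarith
      then have "r = s" using h(2) by simp
      then show ?thesis using x by (simp add: v'_def)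
    qed
    moreover have "v' \<in> F ?J" using v'J hv' Jm Jm' by (simp add: F_iff)
    ultimately have "F ?J = {v'}" by blast
    then have "v' extreme_point_of P"
      using F_face_of_P[OF Jm'] by (simp add: face_of_singleton)
    then show ?thesis using E JE v'J by (auto simp: extreme_point_F)
  qed
  moreover have "v \<noteq> v'" using \<open>s > 0\<close> d'(4) by (auto simp: v'_def)
  ultimately have "adjacent (F E) v v'" using v by (simp add: adjacent_def)
  moreover have "dotp n w v < dotp n w v'" using \<open>s > 0\<close> d'(4) by (simp add: v'_def)
  ultimately show thesis by (intro that) (simp add: oracle_move_def)
qed

lemma not_maximizes_imp_move:
  assumes "E \<subseteq> {..<m}" "v extreme_point_of F E" "\<not> maximizes n w (F E) v"
  obtains v' where "oracle_move n (F E) w v v'"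
proof -
  have "v \<in> F E" using assms(2) by (simp add: extreme_point_of_def)
  then obtain u where "u \<in> F E" "dotp n w v < dotp n w u"
    using assms(3) by (auto simp: maximizes_def not_le)
  then show thesis using improving_neighbour[OF assms(1,2)] that by blast
qed

section \<open>Bounds on values over the box and an integral maximizer\<close>

lemma F_empty: "F {} = P"
  by (auto simp: F_iff)

text \<open>The source of each rounding and stage error \<open>n k\<close>: points of
  \<open>P\<close> differ by at most \<open>k\<close> in every coordinate.\<close>

lemma rdot_diff_bound:
  assumes "x \<in> P" "x' \<in> P" "\<And>j. j < n \<Longrightarrow> \<bar>u j\<bar> \<le> c"
  shows "\<bar>rdot n u x - rdot n u x'\<bar> \<le> real n * c * real k"
proof -
  have "\<bar>rdot n u x - rdot n u x'\<bar> = \<bar>\<Sum>j<n. u j * (coord x j - coord x' j)\<bar>"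
    by (simp add: rdot_def algebra_simps sum_subtractf)
  also have "\<dots> \<le> (\<Sum>j<n. \<bar>u j * (coord x j - coord x' j)\<bar>)" by (rule sum_abs)
  also have "\<dots> \<le> (\<Sum>j<n. c * real k)"
    unfolding abs_mult using assms coord_diff_bound
    by (intro sum_mono mult_mono) (auto intro: order_trans[OF abs_ge_zero])
  finally show ?thesis by (simp add: mult.assoc)
qed

text \<open>Values at vertices are integers in a bounded range, and a vertex of largest value has no
  improving neighbour.\<close>

lemma exists_maximal_vertex:
  assumes x0: "x0 extreme_point_of P"
  obtains x where "x extreme_point_of P" "maximizes n w P x"
proof -
  let ?w = "\<lambda>j. real_of_int (w j)"
  define c where "c = (\<Sum>j<n. \<bar>?w j\<bar>)"
  have c: "\<bar>?w j\<bar> \<le> c" if "j < n" for j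
    unfolding c_def using that by (intro member_le_sum) auto
  \<comment> \<open>The shift keeps the argument nonnegative at vertices, so \<open>nat\<close> does
    not truncate, and an increase by 1 is visible in \<open>f\<close>.\<close>
  define f where "f x = nat \<lfloor>dotp n w x - dotp n w x0 + real n * c * real k\<rfloor>" for x
  have ext: "x \<in> P" if "x extreme_point_of P" for x using that by (simp add: extreme_point_of_def)
  have bound: "\<bar>dotp n w x - dotp n w x0\<bar> \<le> real n * c * real k" if "x extreme_point_of P" for x
    unfolding dotp_eq_rdot using ext[OF that] ext[OF x0] c by (rule rdot_diff_bound)
  have "\<forall>x. x extreme_point_of P \<longrightarrow> f x < Suc (nat \<lfloor>2 * real n * c * real k\<rfloor>)"
  proof (intro allI impI)
    fix x assume "x extreme_point_of P"
    from bound[OF this] show "f x < Suc (nat \<lfloor>2 * real n * c * real k\<rfloor>)"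
      unfolding f_def less_Suc_eq_le by (intro nat_mono floor_mono) linarith
  qed
  then obtain x where x: "x extreme_point_of P"
      and max: "\<And>y. y extreme_point_of P \<Longrightarrow> f y \<le> f x"
    using Lattices_Big.ex_has_greatest_nat[of "\<lambda>x. x extreme_point_of P" x0 f] x0 by blast
  have "maximizes n w P x"
  proof (rule ccontr)
    assume "\<not> maximizes n w P x"
    then obtain y where "oracle_move n P w x y"
      using not_maximizes_imp_move[of "{}" x w] x by (auto simp: F_empty)
    then have y: "y extreme_point_of P" "dotp n w x < dotp n w y"
      by (auto simp: oracle_move_def adjacent_def)
    have "dotp n w x \<in> \<int>" "dotp n w y \<in> \<int>"
      using x y extreme_point_Ints dotp_Ints by blast+
    with y(2) have "dotp n w x + 1 \<le> dotp n w y" by (auto elim!: Ints_cases)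
    then have "f x < f y"
      using bound[OF x] unfolding f_def by linarith
    then show False using max[OF y(1)] by simp
  qed
  with x that show thesis by blast
qed

end


section \<open>Orthogonal projection and rounding\<close>

lemma exists_vector_with_coords:
  obtains z where "z \<in> coord_space n" "\<And>j. j < n \<Longrightarrow> coord z j = u j"
proof -
  let ?f = "\<lambda>j. if j < n then u j else (0::real)"
  have "finite {j. ?f j \<noteq> 0}"
    by (rule finite_subset[of _ "{..<n}"]) auto
  then have "coord (Abs_poly_mapping ?f) = ?f"
    by (simp add: Abs_poly_mapping_inverse)
  then show thesis
    by (intro that[of "Abs_poly_mapping ?f"]) (auto simp: coord_space_iff)
qed

lemma rdot_commute: "rdot n (coord x) y = rdot n (coord y) x"
  by (simp add: rdot_def mult.commute)

lemma rdot_diff_left: "rdot n (\<lambda>j. u j - u' j) x = rdot n u x - rdot n u' x"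
  by (simp add: rdot_def left_diff_distrib sum_subtractf)

lemma rdot_scale_left: "rdot n (\<lambda>j. r * u j) x = r * rdot n u x"
  by (simp add: rdot_def sum_distrib_left mult.assoc)

lemma rdot_self: "rdot n (coord x) x = (\<Sum>j<n. (coord x j)\<^sup>2)"
  by (simp add: rdot_def power2_eq_square)

lemma rdot_self_pos: "x \<in> coord_space n \<Longrightarrow> x \<noteq> 0 \<Longrightarrow> rdot n (coord x) x > 0"
  by (simp add: rdot_self sum_coord_sq_pos)

section \<open>Orthogonal projection onto the kernel of the fixed rows\<close>

lemma kernel_rows_closed:
  assumes "x \<in> kernel_rows n A E" "y \<in> kernel_rows n A E"
  shows "x + y \<in> kernel_rows n A E" "x - y \<in> kernel_rows n A E" "r *\<^sub>R x \<in> kernel_rows n A E"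
  using assms by (auto simp: kernel_rows_def intro: coord_space_closed)

text \<open>One Gram-Schmidt step per row. On the old kernel the new row acts as its own projection
  \<open>a\<close>, so removing the \<open>a\<close>-component of \<open>z\<close> leads into the
  smaller kernel. The functional \<open>u\<close> is arbitrary because the induction hypothesis is
  applied both to the cost and to the row.\<close>

lemma exists_projection:
  assumes "finite E"
  shows "\<exists>z\<in>kernel_rows n A E. \<forall>s\<in>kernel_rows n A E. rdot n u s = rdot n (coord z) s"
  using assms
proof (induction E arbitrary: u rule: finite_induct)
  case empty
  obtain z where "z \<in> coord_space n" "\<And>j. j < n \<Longrightarrow> coord z j = u j"
    using exists_vector_with_coords by blast
  then show ?case
    by (intro bexI[of _ z]) (auto simp: kernel_rows_def rdot_def)
next
  case (insert h E)
  let ?K = "kernel_rows n A E" and ?K' = "kernel_rows n A (insert h E)"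
  have K': "s \<in> ?K' \<longleftrightarrow> s \<in> ?K \<and> dotp n (A h) s = 0" for s
    by (auto simp: kernel_rows_def)
  obtain z where z: "z \<in> ?K" "\<And>s. s \<in> ?K \<Longrightarrow> rdot n u s = rdot n (coord z) s"
    using insert.IH[of u] by blast
  obtain a where a: "a \<in> ?K" "\<And>s. s \<in> ?K \<Longrightarrow> dotp n (A h) s = rdot n (coord a) s"
    using insert.IH[of "\<lambda>j. real_of_int (A h j)"] by (auto simp: dotp_eq_rdot)
  show ?case
  proof (cases "a = 0")
    case True
    then have "?K' = ?K" using a by (auto simp: K' rdot_def)
    then show ?thesis using z by auto
  next
    case False
    have pos: "rdot n (coord a) a > 0"
      using a(1) False by (intro rdot_self_pos) (auto simp: kernel_rows_def)
    define r where "r = rdot n (coord a) z / rdot n (coord a) a"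
    let ?z = "z - r *\<^sub>R a"
    have "?z \<in> ?K" using z(1) a(1) by (intro kernel_rows_closed)
    moreover from this have "dotp n (A h) ?z = rdot n (coord a) ?z" by (rule a(2))
    moreover have "rdot n (coord a) ?z = 0" using pos by (simp add: r_def)
    ultimately have "?z \<in> ?K'" unfolding K' by simp
    moreover have "rdot n u s = rdot n (coord ?z) s" if "s \<in> ?K'" for s
    proof -
      have s: "s \<in> ?K" "dotp n (A h) s = 0" using that K' by auto
      have "rdot n (coord ?z) s = rdot n (coord s) z - r * rdot n (coord s) a"
        unfolding rdot_commute[of n ?z s] by simp
      also have "\<dots> = rdot n (coord z) s"
        using a(2)[OF s(1)] s(2) by (simp add: rdot_commute[of n s])
      finally show ?thesis using z(2)[OF s(1)] by simp
    qed
    ultimately show ?thesis by blast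
  qed
qed

text \<open>Makes the definite description in \<open>orth_proj\<close> usable: two candidates differ
  by a kernel vector that is orthogonal to itself.\<close>

lemma orth_proj_props:
  assumes "finite E"
  shows "orth_proj n (kernel_rows n A E) c \<in> kernel_rows n A E"
    and "s \<in> kernel_rows n A E \<Longrightarrow>
      dotp n c s = rdot n (coord (orth_proj n (kernel_rows n A E) c)) s"
proof -
  let ?K = "kernel_rows n A E"
  let ?Q = "\<lambda>z. z \<in> ?K \<and>
     (\<forall>s\<in>?K. (\<Sum>j<n. (real_of_int (c j) - coord z j) * coord s j) = 0)"
  have Q: "?Q z \<longleftrightarrow> z \<in> ?K \<and> (\<forall>s\<in>?K. dotp n c s = rdot n (coord z) s)" for z
    using rdot_diff_left[of n "\<lambda>j. real_of_int (c j)" "coord z"]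
    by (simp add: dotp_eq_rdot rdot_def)
  have "\<exists>z. ?Q z"
    unfolding Q using exists_projection[OF assms, of n A "\<lambda>j. real_of_int (c j)"]
    by (auto simp: dotp_eq_rdot)
  moreover have "z = z'" if zz: "?Q z" "?Q z'" for z z'
  proof (rule ccontr)
    assume "z \<noteq> z'"
    have d: "z - z' \<in> ?K" using zz by (intro kernel_rows_closed) auto
    then have "rdot n (coord z) (z - z') = rdot n (coord z') (z - z')"
      using zz unfolding Q by metis
    then have "rdot n (coord (z - z')) (z - z') = 0"
      using rdot_diff_left[of n "coord z" "coord z'"] by (simp add: lookup_minus)
    then show False
      using rdot_self_pos[of "z - z'" n] d \<open>z \<noteq> z'\<close> by (simp add: kernel_rows_def)
  qed
  ultimately have "\<exists>!z. ?Q z" by blast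
  then have "?Q (orth_proj n ?K c)" unfolding orth_proj_def by (rule theI')
  then show "orth_proj n ?K c \<in> ?K"
    and "s \<in> ?K \<Longrightarrow> dotp n c s = rdot n (coord (orth_proj n ?K c)) s"
    unfolding Q by blast+
qed

lemma abs_le_linf: "j < n \<Longrightarrow> \<bar>u j\<bar> \<le> linf n u"
  unfolding linf_def by (intro Max_ge) auto

lemma linf_leI: "0 < n \<Longrightarrow> (\<And>j. j < n \<Longrightarrow> \<bar>u j\<bar> \<le> B) \<Longrightarrow> linf n u \<le> B"
  unfolding linf_def by (intro Max.boundedI) auto

lemma linf_attained:
  assumes "0 < n"
  obtains j where "j < n" "linf n u = \<bar>u j\<bar>"
proof -
  have "linf n u \<in> (\<lambda>j. \<bar>u j\<bar>) ` {..<n}"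
    unfolding linf_def using assms by (intro Max_in) auto
  then show thesis using that by auto
qed

section \<open>Rounding the projected cost\<close>

locale rounding =
  fixes n k :: nat and \<alpha> :: int and z :: rvec
  assumes n: "0 < n" and k: "0 < k" and \<alpha>: "0 < \<alpha>"
    and z: "z \<in> coord_space n" "z \<noteq> 0"
begin

abbreviation q :: real where "q \<equiv> real n ^ 3 * real k * real_of_int \<alpha>"

definition unrounded_cost :: "nat \<Rightarrow> real" where "unrounded_cost j = q / linf n (coord z) * coord z j"

abbreviation w :: ivec where "w \<equiv> rounded_cost n k \<alpha> z"

lemma q_pos: "q > 0"
  using n k \<alpha> by simp

lemma linf_pos: "linf n (coord z) > 0"
proof -
  obtain j where "j < n" "coord z j \<noteq> 0"
    using coord_space_eqI[OF z(1) coord_space_0] z(2) by auto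
  then show ?thesis using abs_le_linf[of j n "coord z"] by linarith
qed

lemma rounded_cost_bounds: "real_of_int (w j) \<le> unrounded_cost j" "unrounded_cost j < real_of_int (w j) + 1"
  unfolding rounded_cost_def unrounded_cost_def by linarith+

lemma abs_unrounded_cost_le:
  assumes "j < n"
  shows "\<bar>unrounded_cost j\<bar> \<le> q"
proof -
  have pos: "0 < q / linf n (coord z)" using q_pos linf_pos by simp
  have "\<bar>unrounded_cost j\<bar> = q / linf n (coord z) * \<bar>coord z j\<bar>"
    unfolding unrounded_cost_def abs_mult abs_of_pos[OF pos] ..
  also have "\<dots> \<le> q / linf n (coord z) * linf n (coord z)"
    using abs_le_linf[OF assms, of "coord z"] pos by (intro mult_left_mono) auto
  also have "\<dots> = q" using linf_pos by simp
  finally show ?thesis .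
qed

text \<open>\<open>q\<close> is an integer, so the floors of entries between \<open>- q\<close> and
  \<open>q\<close> stay in this range.\<close>

lemma linf_rounded_cost_le: "real_of_int (linf n w) \<le> q"
proof -
  let ?q = "int n ^ 3 * int k * \<alpha>"
  have "\<bar>w j\<bar> \<le> ?q" if "j < n" for j
  proof -
    have "\<bar>unrounded_cost j\<bar> \<le> real_of_int ?q" using abs_unrounded_cost_le[OF that] by simp
    with rounded_cost_bounds[of j] have "real_of_int (w j) \<le> real_of_int ?q"
      "real_of_int (- ?q) < real_of_int (w j + 1)" unfolding of_int_minus of_int_add by linarith+
    then show ?thesis unfolding of_int_le_iff of_int_less_iff by linarith
  qed
  then have "linf n w \<le> ?q" by (rule linf_leI[OF n])
  then have "real_of_int (linf n w) \<le> real_of_int ?q" by (simp only: of_int_le_iff)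
  then show ?thesis by simp
qed

lemma rdot_unrounded_cost: "rdot n unrounded_cost x = q / linf n (coord z) * rdot n (coord z) x"
  unfolding rdot_def unrounded_cost_def sum_distrib_left by (simp add: mult.assoc)

text \<open>The only entry of \<open>z\<close> attains the maximum norm, so the unrounded entry is
  \<open>q\<close> or \<open>- q\<close>, an integer.\<close>

lemma rounded_cost_exact_dim_1:
  assumes "n = 1"
  shows "dotp n w x = rdot n unrounded_cost x"
proof -
  have "linf n (coord z) = \<bar>coord z 0\<bar>"
    using assms linf_attained[of n "coord z"] by auto
  moreover have "coord z 0 \<noteq> 0" using linf_pos calculation by simp
  ultimately have "unrounded_cost 0 = q \<or> unrounded_cost 0 = - q" unfolding unrounded_cost_def by (auto simp: abs_if)
  moreover have "q = real_of_int (int n ^ 3 * int k * \<alpha>)" by simp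
  ultimately have "unrounded_cost 0 \<in> \<int>" by (metis Ints_of_int Ints_minus)
  then have "real_of_int (w 0) = unrounded_cost 0"
    using rounded_cost_bounds[of 0] by (auto elim!: Ints_cases)
  then show ?thesis using assms by (simp add: dotp_eq_rdot rdot_def)
qed

end


section \<open>Dual solutions\<close>

context lattice_lp
begin

lemma dual_feasible_dotp:
  assumes "dual_feasible n m A E w y"
  shows "dotp n w x = (\<Sum>i<m. y i * dotp n (A i) x)"
proof -
  have "(\<Sum>i<m. y i * dotp n (A i) x) = (\<Sum>i<m. \<Sum>j<n. y i * (real_of_int (A i j) * coord x j))"
    by (simp add: dotp_def sum_distrib_left)
  also have "\<dots> = (\<Sum>j<n. \<Sum>i<m. y i * (real_of_int (A i j) * coord x j))" by (rule sum.swap)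
  also have "\<dots> = (\<Sum>j<n. (\<Sum>i<m. real_of_int (A i j) * y i) * coord x j)"
    by (simp add: sum_distrib_left sum_distrib_right mult_ac)
  also have "\<dots> = dotp n w x"
    using assms by (simp add: dual_feasible_def dotp_def)
  finally show ?thesis by simp
qed

text \<open>Rows in \<open>E\<close> may have negative multipliers, but they have no slack.\<close>

lemma dual_slack_nonneg:
  assumes "E \<subseteq> {..<m}" "x \<in> F E" "dual_feasible n m A E w y" "i < m"
  shows "0 \<le> y i * (real_of_int (b i) - dotp n (A i) x)"
  using assms by (cases "i \<in> E") (auto simp: F_iff P_iff dual_feasible_def intro!: mult_nonneg_nonneg)

text \<open>Since the terms on the right are nonnegative on the face, weak duality and complementary
  slackness can both be read off.\<close>

lemma duality_gap:
  assumes "dual_feasible n m A E w y"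
  shows "(\<Sum>i<m. real_of_int (b i) * y i) - dotp n w x
    = (\<Sum>i<m. y i * (real_of_int (b i) - dotp n (A i) x))"
  by (simp add: dual_feasible_dotp[OF assms] algebra_simps sum_subtractf)

lemma weak_duality:
  assumes "E \<subseteq> {..<m}" "x \<in> F E" "dual_feasible n m A E w y"
  shows "dotp n w x \<le> (\<Sum>i<m. real_of_int (b i) * y i)"
proof -
  have "0 \<le> (\<Sum>i<m. y i * (real_of_int (b i) - dotp n (A i) x))"
    using dual_slack_nonneg[OF assms] by (intro sum_nonneg) simp
  then show ?thesis using duality_gap[OF assms(3), of x] by linarith
qed

lemma row_in_span_dotp_zero:
  assumes "row_in_span n A E j" "\<And>i. i \<in> E \<Longrightarrow> dotp n (A i) x = 0"
  shows "dotp n (A j) x = 0"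
proof -
  obtain r :: "nat \<Rightarrow> real"
    where r: "\<And>l. l < n \<Longrightarrow> real_of_int (A j l) = (\<Sum>i\<in>E. r i * real_of_int (A i l))"
    using assms(1) by (auto simp: row_in_span_def)
  have "dotp n (A j) x = (\<Sum>l<n. \<Sum>i\<in>E. r i * (real_of_int (A i l) * coord x l))"
    by (simp add: dotp_def r sum_distrib_right mult.assoc)
  also have "\<dots> = (\<Sum>i\<in>E. r i * dotp n (A i) x)"
    by (subst sum.swap) (simp add: dotp_def sum_distrib_left)
  finally show ?thesis using assms(2) by simp
qed

text \<open>Tight rows in the span of \<open>E\<close> vanish wherever the rows of \<open>E\<close> do, so Farkas' lemma can be
  applied without them; this gives condition (ii) of Step 3, and Caratheodory's argument gives (i).\<close>

lemma exists_admissible_dual: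
  assumes E: "E \<subseteq> {..<m}" and max: "maximizes n w (F E) v"
  obtains y where "admissible_dual n m A b E w y"
    "(\<Sum>i<m. real_of_int (b i) * y i) = dotp n w v"
proof -
  have vF: "v \<in> F E" and le: "\<And>x. x \<in> F E \<Longrightarrow> dotp n w x \<le> dotp n w v"
    using max by (auto simp: maximizes_def)
  have ET: "E \<subseteq> tight v" using vF E by (auto simp: tight_def F_iff)
  define I where "I = E \<union> {i \<in> tight v. \<not> row_in_span n A E i}"
  have IT: "I \<subseteq> tight v" using ET by (auto simp: I_def)
  have finI: "finite I" using IT finite_tight by (rule finite_subset)
  have Im: "I \<subseteq> {..<m}" using IT by (auto simp: tight_def)
  have cone: "dotp n w x \<le> 0"
    if x: "\<And>i. i \<in> I \<Longrightarrow> dotp n (A i) x \<le> 0" "\<And>i. i \<in> I \<inter> E \<Longrightarrow> dotp n (A i) x = 0" for x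
  proof -
    \<comment> \<open>Farkas' lemma ranges over all sequences, feasible directions only over
      \<open>coord_space n\<close>; entries from index \<open>n\<close> on do not affect
      \<open>dotp\<close>.\<close>
    obtain d where d: "d \<in> coord_space n" "\<And>j. j < n \<Longrightarrow> coord d j = coord x j"
      using exists_vector_with_coords by blast
    then have same: "dotp n u d = dotp n u x" for u by (simp add: dotp_def)
    have dE: "dotp n (A i) d = 0" if "i \<in> E" for i
      using x(2)[of i] that by (simp add: same I_def)
    have "dotp n (A i) d \<le> 0" if "i \<in> tight v" for i
    proof (cases "row_in_span n A E i")
      case True
      then show ?thesis using row_in_span_dotp_zero[OF True] dE by simp
    next
      case False
      then show ?thesis using x(1)[of i] that by (simp add: same I_def)
    qed
    with feasible_step[OF E vF d(1) dE] obtain s where s: "s > 0" "v + s *\<^sub>R d \<in> F E" by blast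
    then have "s * dotp n w d \<le> 0" using le[OF s(2)] by simp
    then show ?thesis using s(1) by (simp add: same mult_le_0_iff)
  qed
  have "\<exists>y. (\<forall>i\<in>I - E. 0 \<le> y i) \<and> (\<forall>x. dotp n w x = (\<Sum>i\<in>I. y i * dotp n (A i) x))"
    by (rule farkas[where f = "\<lambda>i. dotp n (A i)" and g = "dotp n w", OF finI linear_dotp linear_dotp])
      (rule cone)
  then obtain y0 where y0: "\<forall>i\<in>I - E. 0 \<le> y0 i"
      "\<And>x. dotp n w x = (\<Sum>i\<in>I. y0 i * dotp n (A i) x)" by metis
  have w_eq: "(\<Sum>i\<in>I. y0 i * real_of_int (A i l)) = real_of_int (w l)" if "l < n" for l
    using y0(2)[of "Poly_Mapping.single l 1"] that by (simp add: dotp_single)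
  have "\<exists>y. (\<forall>i\<in>I - E. 0 \<le> y i)
      \<and> (\<forall>l<n. (\<Sum>i\<in>I. y i * real_of_int (A i l)) = real_of_int (w l)) \<and> card {i\<in>I. y i \<noteq> 0} \<le> n"
    using finI y0(1) w_eq by (rule conic_caratheodory)
  then obtain y1 where y1: "\<forall>i\<in>I - E. 0 \<le> y1 i"
      "\<And>l. l < n \<Longrightarrow> (\<Sum>i\<in>I. y1 i * real_of_int (A i l)) = real_of_int (w l)"
      "card {i\<in>I. y1 i \<noteq> 0} \<le> n" by auto
  define y where "y i = (if i \<in> I then y1 i else 0)" for i
  have sumI: "(\<Sum>i<m. g i * y i) = (\<Sum>i\<in>I. y1 i * g i)" for g
  proof -
    have "(\<Sum>i<m. g i * y i) = (\<Sum>i\<in>I. g i * y i)"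
      using Im by (intro sum.mono_neutral_right) (auto simp: y_def)
    then show ?thesis by (simp add: y_def mult.commute)
  qed
  have feas: "dual_feasible n m A E w y"
    using y1(1,2) by (auto simp: dual_feasible_def sumI) (auto simp: y_def)
  \<comment> \<open>\<open>y\<close> is supported on tight rows: complementary slackness closes the
    duality gap.\<close>
  have "y i * (real_of_int (b i) - dotp n (A i) v) = 0" for i
    using IT by (auto simp: y_def tight_def)
  then have "(\<Sum>i<m. y i * (real_of_int (b i) - dotp n (A i) v)) = 0"
    by (intro sum.neutral ballI)
  then have val: "(\<Sum>i<m. real_of_int (b i) * y i) = dotp n w v"
    using duality_gap[OF feas, of v] by simp
  have "{i \<in> {..<m}. y i \<noteq> 0} = {i \<in> I. y1 i \<noteq> 0}" using Im by (auto simp: y_def)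
  moreover have "y j = 0" if "j \<in> {..<m} - E" "row_in_span n A E j" for j
    using that by (auto simp: y_def I_def)
  ultimately have "admissible_dual n m A b E w y"
    using feas val weak_duality[OF E vF] y1(3)
    by (auto simp: admissible_dual_def dual_optimal_def)
  with val that show thesis by blast
qed

text \<open>Strong duality: the optimal \<open>y\<close> is compared with a dual solution that
  attains the primal value.\<close>

lemma dual_optimal_value:
  assumes "E \<subseteq> {..<m}" "maximizes n w (F E) v" "dual_optimal n m A b E w y"
  shows "(\<Sum>i<m. real_of_int (b i) * y i) = dotp n w v"
proof (rule antisym)
  obtain y' where "admissible_dual n m A b E w y'" "(\<Sum>i<m. real_of_int (b i) * y' i) = dotp n w v"
    using exists_admissible_dual[OF assms(1,2)] .
  then show "(\<Sum>i<m. real_of_int (b i) * y i) \<le> dotp n w v"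
    using assms(3) by (auto simp: admissible_dual_def dual_optimal_def)
  show "dotp n w v \<le> (\<Sum>i<m. real_of_int (b i) * y i)"
    using assms by (intro weak_duality) (auto simp: maximizes_def dual_optimal_def)
qed

lemma F_diff_kernel: "E \<subseteq> {..<m} \<Longrightarrow> x \<in> F E \<Longrightarrow> x' \<in> F E \<Longrightarrow> x - x' \<in> kernel_rows n A E"
  by (auto simp: kernel_rows_def F_iff P_iff intro: coord_space_closed)

end

section \<open>The rounded linear program on the current face\<close>

locale rounded_lp = lattice_lp +
  fixes c :: ivec and E :: "nat set" and z :: rvec
  assumes n: "0 < n" and k: "0 < k" and \<alpha>: "0 < max_entry n m A"
    and E: "E \<subseteq> {..<m}" and z_eq: "z = orth_proj n (kernel_rows n A E) c" and z: "z \<noteq> 0"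
begin

lemma finite_E: "finite E"
  using E finite_subset by blast

lemma z_kernel: "z \<in> kernel_rows n A E"
  unfolding z_eq by (rule orth_proj_props(1)[OF finite_E])

sublocale rounding n k "max_entry n m A" z
  using n k \<alpha> z z_kernel by unfold_locales (auto simp: kernel_rows_def)

text \<open>Points of the current face differ by a kernel vector, on which \<open>c\<close> and its
  projection agree.\<close>

lemma dotp_c_diff:
  assumes "x \<in> F E" "x' \<in> F E"
  shows "q / linf n (coord z) * (dotp n c x - dotp n c x') = rdot n unrounded_cost x - rdot n unrounded_cost x'"
  using orth_proj_props(2)[OF finite_E F_diff_kernel[OF E assms], of c]
  unfolding z_eq[symmetric] by (simp add: rdot_unrounded_cost right_diff_distrib)

lemma unrounded_cost_le_iff:
  assumes "x \<in> F E" "x' \<in> F E"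
  shows "rdot n unrounded_cost x' \<le> rdot n unrounded_cost x \<longleftrightarrow> dotp n c x' \<le> dotp n c x"
proof -
  have "q / linf n (coord z) > 0" using q_pos linf_pos by simp
  then have "0 \<le> rdot n unrounded_cost x - rdot n unrounded_cost x' \<longleftrightarrow> 0 \<le> dotp n c x - dotp n c x'"
    unfolding dotp_c_diff[OF assms, symmetric] by (simp only: zero_le_mult_iff) linarith
  then show ?thesis by simp
qed

text \<open>If row \<open>h\<close> were not tight at the integral point \<open>xh\<close>, its slack would be at least 1, so
  \<open>xh\<close> would lose more than \<open>n k\<close> against \<open>v\<close>; but rounding changes this difference by at most \<open>n k\<close>.\<close>

lemma fixed_row_tight:
  assumes v: "maximizes n w (F E) v" and y: "dual_optimal n m A b E w y"
    and h: "h < m" "h \<notin> E" "y h > real n * real k"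
    and xh: "xh extreme_point_of P" "xh \<in> F E" "maximizes n c P xh"
  shows "dotp n (A h) xh = real_of_int (b h)"
proof (rule ccontr)
  assume neq: "dotp n (A h) xh \<noteq> real_of_int (b h)"
  have vF: "v \<in> F E" using v by (simp add: maximizes_def)
  have feas: "dual_feasible n m A E w y" using y by (simp add: dual_optimal_def)
  have "dotp n (A h) xh \<in> \<int>"
    using extreme_point_Ints[OF xh(1)] by (rule dotp_Ints)
  moreover have "dotp n (A h) xh < real_of_int (b h)"
    using neq xh(2) E h(1) by (auto simp: F_iff P_iff less_le)
  ultimately have "1 \<le> real_of_int (b h) - dotp n (A h) xh" by (auto elim!: Ints_cases)
  moreover have "0 \<le> y h" using h(3) by (rule order_trans[OF _ less_imp_le, rotated]) simp
  ultimately have "y h * 1 \<le> y h * (real_of_int (b h) - dotp n (A h) xh)"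
    by (rule mult_left_mono)
  also have "\<dots> \<le> (\<Sum>i<m. y i * (real_of_int (b i) - dotp n (A i) xh))"
    using h(1) dual_slack_nonneg[OF E xh(2) feas] by (intro member_le_sum) auto
  also have "\<dots> = dotp n w v - dotp n w xh"
    using duality_gap[OF feas, of xh] dual_optimal_value[OF E v y] by simp
  finally have "real n * real k < dotp n w v - dotp n w xh" using h(3) by simp
  moreover have "\<bar>rdot n (\<lambda>j. unrounded_cost j - real_of_int (w j)) v - rdot n (\<lambda>j. unrounded_cost j - real_of_int (w j)) xh\<bar>
      \<le> real n * 1 * real k"
  proof (rule rdot_diff_bound)
    show "v \<in> P" "xh \<in> P" using vF xh(2) F_subset_P[OF E] by auto
    show "\<bar>unrounded_cost j - real_of_int (w j)\<bar> \<le> 1" for j using rounded_cost_bounds[of j] by linarith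
  qed
  moreover have "rdot n unrounded_cost v \<le> rdot n unrounded_cost xh"
    using xh(3) vF F_subset_P[OF E] by (auto simp: unrounded_cost_le_iff[OF xh(2) vF] maximizes_def)
  ultimately show False by (simp add: rdot_diff_left dotp_eq_rdot)
qed

text \<open>Rounding loses nothing here, so \<open>v\<close> is at least as good as
  \<open>xh\<close> for \<open>c\<close> itself.\<close>

lemma maximizes_c_dim_1:
  assumes "n = 1" "maximizes n w (F E) v" "xh \<in> F E" "maximizes n c P xh"
  shows "maximizes n c P v"
proof -
  have vF: "v \<in> F E" using assms(2) by (simp add: maximizes_def)
  have "rdot n unrounded_cost xh \<le> rdot n unrounded_cost v"
    using assms(2,3) rounded_cost_exact_dim_1[OF assms(1)] by (simp add: maximizes_def)
  then have "dotp n c xh \<le> dotp n c v" by (simp add: unrounded_cost_le_iff[OF vF assms(3)])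
  then show ?thesis
    using assms(4) vF F_subset_P[OF E] by (force simp: maximizes_def)
qed

lemma abs_entry_le: "i < m \<Longrightarrow> j < n \<Longrightarrow> \<bar>A i j\<bar> \<le> max_entry n m A"
  unfolding max_entry_def by (rule Max_ge) (auto intro!: image_eqI[of _ _ "(i, j)"])

lemma abs_dotp_row_le:
  assumes "i < m"
  shows "\<bar>dotp n (A i) x\<bar> \<le> real_of_int (max_entry n m A) * (\<Sum>j<n. \<bar>coord x j\<bar>)"
proof -
  have "\<bar>dotp n (A i) x\<bar> \<le> (\<Sum>j<n. \<bar>real_of_int (A i j) * coord x j\<bar>)"
    unfolding dotp_def by (rule sum_abs)
  also have "\<dots> \<le> (\<Sum>j<n. real_of_int (max_entry n m A) * \<bar>coord x j\<bar>)"
  proof (rule sum_mono)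
    fix j assume "j \<in> {..<n}"
    then have "real_of_int \<bar>A i j\<bar> \<le> real_of_int (max_entry n m A)"
      using abs_entry_le[OF assms] by (simp only: of_int_le_iff lessThan_iff)
    then show "\<bar>real_of_int (A i j) * coord x j\<bar> \<le> real_of_int (max_entry n m A) * \<bar>coord x j\<bar>"
      by (simp add: abs_mult mult_right_mono)
  qed
  finally show ?thesis by (simp add: sum_distrib_left)
qed

text \<open>Pair the rounded cost with the projection \<open>z\<close>, on which the rows of \<open>E\<close> vanish.\<close>

lemma exists_large_dual_entry:
  assumes n2: "2 \<le> n" and feas: "dual_feasible n m A E w y"
    and card: "card {i \<in> {..<m}. y i \<noteq> 0} \<le> n"
  shows "\<exists>h<m. h \<notin> E \<and> y h > real n * real k"
proof (rule ccontr)
  assume "\<not> ?thesis"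
  then have small: "y i \<le> real n * real k" if "i < m" "i \<notin> E" for i
    using that by (meson not_less)
  define g where "g = real k * real_of_int (max_entry n m A)"
  define M where "M = linf n (coord z)"
  define r where "r = (\<Sum>j<n. \<bar>coord z j\<bar>)"
  define s where "s = (\<Sum>j<n. (coord z j)\<^sup>2)"
  define S where "S = {i \<in> {..<m}. y i \<noteq> 0} - E"
  have "1 \<le> k" "1 \<le> max_entry n m A" using k \<alpha> by linarith+
  then have g1: "1 \<le> g"
    unfolding g_def using mult_mono[of 1 "real k" 1 "real_of_int (max_entry n m A)"] by simp
  have M: "M > 0" using linf_pos by (simp add: M_def)
  have s: "s > 0" using rdot_self_pos[of z n] rounding_axioms
    by (simp add: s_def rdot_self rounding_def)
  have r: "r \<ge> 0" by (simp add: r_def sum_nonneg)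
  have q: "q = real n ^ 3 * g" by (simp add: g_def)
  have cS: "card S \<le> n"
    using card by (rule order_trans[rotated]) (auto simp: S_def intro: card_mono)
  have "dotp n w z = (\<Sum>i<m. y i * dotp n (A i) z)" by (rule dual_feasible_dotp[OF feas])
  \<comment> \<open>The rows in \<open>E\<close> vanish on \<open>z\<close>, so their multipliers,
    which may have any sign, drop out.\<close>
  also have "\<dots> = (\<Sum>i\<in>S. y i * dotp n (A i) z)"
    using z_kernel by (intro sum.mono_neutral_right) (auto simp: S_def kernel_rows_def)
  also have "\<dots> \<le> (\<Sum>i\<in>S. real n * real k * (real_of_int (max_entry n m A) * r))"
  proof (rule sum_mono)
    fix i assume i: "i \<in> S"
    then have "0 \<le> y i" using feas by (auto simp: S_def dual_feasible_def)
    have "y i * dotp n (A i) z \<le> y i * \<bar>dotp n (A i) z\<bar>"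
      using \<open>0 \<le> y i\<close> by (intro mult_left_mono) auto
    also have "\<dots> \<le> real n * real k * (real_of_int (max_entry n m A) * r)"
      using i small[of i] abs_dotp_row_le[of i z]
      by (intro mult_mono) (auto simp: S_def r_def)
    finally show "y i * dotp n (A i) z \<le> real n * real k * (real_of_int (max_entry n m A) * r)" .
  qed
  also have "\<dots> = real (card S) * (real n * g * r)" by (simp add: g_def)
  also have "\<dots> \<le> real n * (real n * g * r)"
    using cS g1 r by (intro mult_right_mono) auto
  finally have upper: "dotp n w z \<le> real n ^ 2 * g * r" by (simp add: power2_eq_square mult_ac)
  \<comment> \<open>Each entry loses less than 1 in rounding, hence the pairing with
    \<open>z\<close> at most \<open>r\<close>.\<close>
  have "rdot n unrounded_cost z - dotp n w z = (\<Sum>j<n. (unrounded_cost j - real_of_int (w j)) * coord z j)"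
    by (simp add: dotp_eq_rdot rdot_diff_left[symmetric]) (simp add: rdot_def)
  also have "\<dots> \<le> (\<Sum>j<n. 1 * \<bar>coord z j\<bar>)"
  proof (rule sum_mono)
    fix j
    have "(unrounded_cost j - real_of_int (w j)) * coord z j \<le> (unrounded_cost j - real_of_int (w j)) * \<bar>coord z j\<bar>"
      using rounded_cost_bounds[of j] by (intro mult_left_mono) auto
    also have "\<dots> \<le> 1 * \<bar>coord z j\<bar>"
      using rounded_cost_bounds[of j] by (intro mult_right_mono) auto
    finally show "(unrounded_cost j - real_of_int (w j)) * coord z j \<le> 1 * \<bar>coord z j\<bar>" .
  qed
  finally have "rdot n unrounded_cost z \<le> (real n ^ 2 * g + 1) * r"
    using upper by (simp add: r_def algebra_simps)
  then have "q / M * s \<le> (real n ^ 2 * g + 1) * r"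
    by (simp only: rdot_unrounded_cost rdot_self s_def M_def)
  then have "q * s \<le> (real n ^ 2 * g + 1) * (M * r)"
    using M by (simp add: field_simps)
  \<comment> \<open>Squaring avoids the root in the Cauchy-Schwarz bound
    \<open>M r <= sqrt n s\<close>.\<close>
  then have "(q * s)\<^sup>2 \<le> ((real n ^ 2 * g + 1) * (M * r))\<^sup>2"
    using q_pos s by (intro power_mono) auto
  also have "\<dots> = (real n ^ 2 * g + 1)\<^sup>2 * (M\<^sup>2 * r\<^sup>2)"
    by (simp add: power_mult_distrib)
  also have "\<dots> \<le> (real n ^ 2 * g + 1)\<^sup>2 * (s * (real n * s))"
  proof (intro mult_left_mono mult_mono)
    obtain j where "j < n" "M = \<bar>coord z j\<bar>" using linf_attained[OF n] M_def by metis
    then show "M\<^sup>2 \<le> s" unfolding s_def power2_abs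
      by (simp, intro member_le_sum) auto
    have "r\<^sup>2 \<le> (\<Sum>j<n. \<bar>coord z j\<bar>\<^sup>2) * real (card {..<n})"
      unfolding r_def by (rule sum_squared_le_sum_of_squares)
    then show "r\<^sup>2 \<le> real n * s" by (simp add: s_def mult.commute)
  qed (use s in auto)
  finally have "q\<^sup>2 * s\<^sup>2 \<le> (real n ^ 2 * g + 1)\<^sup>2 * real n * s\<^sup>2"
    unfolding power_mult_distrib by (simp only: power2_eq_square mult_ac)
  then have "q\<^sup>2 \<le> (real n ^ 2 * g + 1)\<^sup>2 * real n" using s by (simp only: mult_le_cancel_right) auto
  \<comment> \<open>In terms of \<open>t\<close> the inequality reads
    \<open>n t^2 <= (t + 1)^2\<close>, which for \<open>n >= 2\<close> contradicts
    \<open>t >= 4\<close>.\<close>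
  moreover define t where "t = real n ^ 2 * g"
  moreover have "(real n ^ 3 * g)\<^sup>2 = real n * t\<^sup>2 * real n"
    by (simp add: t_def power_mult_distrib eval_nat_numeral mult_ac)
  ultimately have "real n * t\<^sup>2 * real n \<le> (t + 1)\<^sup>2 * real n"
    unfolding q by simp
  then have "real n * t\<^sup>2 \<le> (t + 1)\<^sup>2" using n by (simp only: mult_le_cancel_right)
  moreover have "2 * t\<^sup>2 \<le> real n * t\<^sup>2" using n2 by (intro mult_right_mono) auto
  ultimately have "t * t \<le> 2 * t + 1" by (simp add: power2_eq_square algebra_simps)
  moreover have "2 * 2 * 1 \<le> real n ^ 2 * g"
    using n2 g1 unfolding power2_eq_square by (intro mult_mono) auto
  then have "4 \<le> t" by (simp add: t_def)
  moreover from this have "4 * t \<le> t * t" by (intro mult_right_mono) auto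
  ultimately show False by linarith
qed

end


section \<open>Scaled costs\<close>

lemma linf_le_two_power_depth: "real_of_int (linf n w) \<le> 2 ^ scaling_depth n w"
proof (cases "linf n w > 0")
  case True
  then have "real_of_int (linf n w) = 2 powr log 2 (real_of_int (linf n w))" by simp
  also have "\<dots> \<le> 2 powr real (scaling_depth n w)"
    unfolding scaling_depth_def by (intro powr_mono real_nat_ceiling_ge) auto
  finally show ?thesis by (simp add: powr_realpow)
next
  case False
  then have "real_of_int (linf n w) \<le> 0" by simp
  also have "(0::real) \<le> 2 ^ scaling_depth n w" by simp
  finally show ?thesis .
qed

lemma scaled_cost_final: "scaling_depth n w \<le> t \<Longrightarrow> scaled_cost n w t = w"
  by (simp add: scaled_cost_def)

text \<open>Division by the full power of 2 brings every entry into [-1, 1], so the first stage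
  starts with a gap of at most n k, like all others.\<close>

lemma abs_scaled_cost_0_le:
  assumes "j < n"
  shows "\<bar>scaled_cost n w 0 j\<bar> \<le> 1"
proof -
  have "\<bar>w j\<bar> \<le> linf n w" by (rule abs_le_linf[OF assms])
  then have "\<bar>real_of_int (w j)\<bar> \<le> 2 ^ scaling_depth n w"
    using linf_le_two_power_depth[of n w] by linarith
  then have "\<bar>real_of_int (w j) / 2 ^ scaling_depth n w\<bar> \<le> 1" by simp
  then show ?thesis unfolding scaled_cost_def diff_zero by linarith
qed

lemma scaled_cost_Suc:
  assumes "t < scaling_depth n w"
  shows "\<bar>2 * scaled_cost n w t j - scaled_cost n w (Suc t) j\<bar> \<le> 1"
proof -
  let ?u = "real_of_int (w j) / 2 ^ (scaling_depth n w - t)"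
  have "scaling_depth n w - t = Suc (scaling_depth n w - Suc t)" using assms by simp
  then have "real_of_int (w j) / 2 ^ (scaling_depth n w - Suc t) = 2 * ?u" by simp
  moreover have "\<bar>2 * \<lceil>?u\<rceil> - \<lceil>2 * ?u\<rceil>\<bar> \<le> 1" by linarith
  ultimately show ?thesis by (simp only: scaled_cost_def)
qed


section \<open>Invariant of the iterative algorithm\<close>

locale iteration = lattice_lp +
  fixes c :: ivec and x0 xh :: rvec
  assumes n: "0 < n" and k: "0 < k" and \<alpha>: "0 < max_entry n m A"
    and x0: "x0 extreme_point_of P"
    and xh: "xh extreme_point_of P" "maximizes n c P xh"
begin

abbreviation proj :: "nat set \<Rightarrow> rvec" where
  "proj E \<equiv> orth_proj n (kernel_rows n A E) c"

definition independent_rows :: "nat set \<Rightarrow> bool" where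
  "independent_rows E \<longleftrightarrow> (\<forall>\<mu>::nat \<Rightarrow> real.
     (\<forall>l<n. (\<Sum>i\<in>E. \<mu> i * real_of_int (A i l)) = 0) \<longrightarrow> (\<forall>i\<in>E. \<mu> i = 0))"

text \<open>The integral maximizer \<open>xh\<close> of \<open>c\<close> over \<open>P\<close> is chosen once; it never leaves the current face.\<close>

definition good_rows :: "nat set \<Rightarrow> bool" where
  "good_rows E \<longleftrightarrow> E \<subseteq> {..<m} \<and> xh \<in> F E \<and> independent_rows E"

definition path_to :: "rvec list \<Rightarrow> rvec \<Rightarrow> bool" where
  "path_to p v \<longleftrightarrow> simplex_path P p \<and> hd p = x0 \<and> last p = v"

text \<open>Uniform over all rounds, as it comes from the common bound on the entries of every
  rounded cost.\<close>

definition max_depth :: nat where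
  "max_depth = nat \<lceil>log 2 (real n ^ 3 * real k * real_of_int (max_entry n m A))\<rceil>"

definition round_bound :: nat where
  "round_bound = Suc max_depth * (n * k)"

text \<open>While the basic algorithm runs with the cost of stage \<open>t\<close>, the number of moves still to come
  is at most the gap between the optimum and the current value, by integrality.\<close>

definition stage_inv :: "nat set \<Rightarrow> ivec \<Rightarrow> nat \<Rightarrow> rvec \<Rightarrow> rvec list \<Rightarrow> bool" where
  "stage_inv E w t v p \<longleftrightarrow>
     (if t \<le> scaling_depth n w
      then \<forall>x\<in>F E. real (length p) + dotp n (scaled_cost n w t) x - dotp n (scaled_cost n w t) v
          \<le> real (1 + card E * round_bound + Suc t * (n * k))
      else t = Suc (scaling_depth n w) \<and> maximizes n w (F E) v \<and>
        length p \<le> 1 + Suc (card E) * round_bound)"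

text \<open>A path has one vertex more than it has edges, hence the leading 1. The factor
  \<open>Suc n\<close> budgets one round for each size 0, ..., n of \<open>E\<close>.\<close>

fun inv :: "iter_state \<times> rvec list \<Rightarrow> bool" where
  "inv (Step1 E x, p) \<longleftrightarrow> good_rows E \<and> x \<in> F E \<and> path_to p x \<and>
     length p \<le> 1 + card E * round_bound"
| "inv (Step3 E w t v, p) \<longleftrightarrow> good_rows E \<and> v \<in> F E \<and> path_to p v \<and> proj E \<noteq> 0 \<and>
     w = rounded_cost n k (max_entry n m A) (proj E) \<and> stage_inv E w t v p"
| "inv (Returned x, p) \<longleftrightarrow> path_to p x \<and> maximizes n c P x \<and>
     length p \<le> 1 + Suc n * round_bound"

lemma path_to_extreme: "path_to p v \<Longrightarrow> v extreme_point_of P"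
  by (auto simp: path_to_def simplex_path_def)

lemma extreme_F: "good_rows E \<Longrightarrow> v \<in> F E \<Longrightarrow> path_to p v \<Longrightarrow> v extreme_point_of F E"
  by (auto simp: extreme_point_F good_rows_def path_to_extreme)

lemma path_to_snoc:
  assumes "path_to p v" "adjacent P v v'"
  shows "path_to (p @ [v']) v'"
  using assms by (auto simp: path_to_def simplex_path_def successively_append_iff adjacent_def)

lemma finite_good_rows: "good_rows E \<Longrightarrow> finite E"
  using finite_subset by (auto simp: good_rows_def)

lemma card_good_rows:
  assumes "good_rows E"
  shows "card E \<le> n"
proof (rule ccontr)
  assume "\<not> card E \<le> n"
  then have "\<exists>\<mu>. (\<exists>i\<in>E. \<mu> i \<noteq> 0) \<and> (\<forall>l<n. (\<Sum>i\<in>E. \<mu> i * real_of_int (A i l)) = 0)"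
    using finite_good_rows[OF assms]
    by (intro exists_linear_dependency[where a = "\<lambda>i l. real_of_int (A i l)"]) auto
  then show False using assms by (auto simp: good_rows_def independent_rows_def)
qed

lemma independent_rows_insert:
  assumes fin: "finite E" "h \<notin> E" and ind: "independent_rows E" and h: "\<not> row_in_span n A E h"
  shows "independent_rows (insert h E)"
  unfolding independent_rows_def
proof (intro allI impI)
  fix \<mu> :: "nat \<Rightarrow> real"
  assume dep: "\<forall>l<n. (\<Sum>i\<in>insert h E. \<mu> i * real_of_int (A i l)) = 0"
  have eq: "\<mu> h * real_of_int (A h l) + (\<Sum>i\<in>E. \<mu> i * real_of_int (A i l)) = 0" if "l < n" for l
    using dep that fin by simp
  have "\<mu> h = 0"
  proof (rule ccontr)
    assume nz: "\<mu> h \<noteq> 0"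
    have "real_of_int (A h l) = (\<Sum>i\<in>E. (- \<mu> i / \<mu> h) * real_of_int (A i l))" if "l < n" for l
    proof -
      have "(\<Sum>i\<in>E. (- \<mu> i / \<mu> h) * real_of_int (A i l))
          = - (\<Sum>i\<in>E. \<mu> i * real_of_int (A i l)) / \<mu> h"
        by (simp add: sum_divide_distrib sum_negf)
      also have "\<dots> = \<mu> h * real_of_int (A h l) / \<mu> h"
        using eq[OF that] by (simp add: eq_neg_iff_add_eq_0[symmetric])
      finally show ?thesis using nz by simp
    qed
    then have "row_in_span n A E h"
      unfolding row_in_span_def by (intro exI[of _ "\<lambda>i. - \<mu> i / \<mu> h"]) blast
    then show False using h by blast
  qed
  then show "\<forall>i\<in>insert h E. \<mu> i = 0"
    using eq ind by (simp add: independent_rows_def)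
qed

lemma rounded_lp_proj:
  assumes "good_rows E" "proj E \<noteq> 0"
  shows "rounded_lp n m k A b c E (proj E)"
  using assms box n k \<alpha> by unfold_locales (auto simp: good_rows_def)

lemma depth_le:
  assumes "good_rows E" "proj E \<noteq> 0"
  shows "scaling_depth n (rounded_cost n k (max_entry n m A) (proj E)) \<le> max_depth"
proof -
  interpret rounded_lp n m k A b c E "proj E" by (rule rounded_lp_proj[OF assms])
  have "log 2 (real_of_int (linf n w)) \<le> log 2 q"
  proof (cases "linf n w > 0")
    case True
    then show ?thesis using linf_rounded_cost_le q_pos by (subst log_le_cancel_iff) auto
  next
    \<comment> \<open>Here \<open>linf n w\<close> is 0, whose logarithm is 0 by convention.\<close>
    case False
    have "1 \<le> real_of_int (int n ^ 3 * int k * max_entry n m A)"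
      unfolding of_int_1_le_iff using n k \<alpha> by (simp add: int_one_le_iff_zero_less)
    then have "1 \<le> q" by simp
    then have "0 \<le> log 2 q" by (subst zero_le_log_cancel_iff) auto
    moreover have "linf n w \<ge> 0" using abs_le_linf[OF n, of w] by linarith
    then have "linf n w = 0" using False by simp
    ultimately show ?thesis by (simp add: log_def)
  qed
  then show ?thesis
    unfolding scaling_depth_def max_depth_def by (intro nat_mono ceiling_mono)
qed

text \<open>The gap in the invariant vanishes at \<open>x = v\<close>.\<close>

lemma stage_inv_length:
  assumes "stage_inv E w t v p" "v \<in> F E" "t \<le> scaling_depth n w"
  shows "length p \<le> 1 + card E * round_bound + Suc t * (n * k)"
proof -
  have "real (length p) \<le> real (1 + card E * round_bound + Suc t * (n * k))"
    using assms by (force simp: stage_inv_def)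
  then show ?thesis by (simp only: of_nat_le_iff)
qed

lemma round_bound_ge: "t \<le> max_depth \<Longrightarrow> Suc t * (n * k) \<le> round_bound"
  unfolding round_bound_def by (intro mult_right_mono) auto

lemma inv_length:
  assumes "inv (s, p)"
  shows "length p \<le> 1 + Suc n * round_bound"
proof (cases s)
  case (Step1 E x)
  then have "card E * round_bound \<le> Suc n * round_bound"
    using assms card_good_rows[of E] by (intro mult_right_mono) auto
  then show ?thesis using assms Step1 by simp
next
  case (Step3 E w t v)
  have E: "good_rows E" "proj E \<noteq> 0" using assms Step3 by auto
  have "Suc (card E) * round_bound \<le> Suc n * round_bound"
    using card_good_rows[OF E(1)] by (intro mult_right_mono) auto
  moreover have "length p \<le> 1 + Suc (card E) * round_bound"
  proof (cases "t \<le> scaling_depth n w")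
    case True
    then have "length p \<le> 1 + card E * round_bound + Suc t * (n * k)"
      using assms Step3 by (intro stage_inv_length) auto
    moreover have "Suc t * (n * k) \<le> round_bound"
      using True depth_le[OF E] assms Step3 by (intro round_bound_ge) auto
    ultimately show ?thesis by simp
  next
    case False
    then show ?thesis using assms Step3 by (auto simp: stage_inv_def)
  qed
  ultimately show ?thesis by linarith
qed (use assms in auto)

section \<open>Preservation of the invariant\<close>

lemma inv_initial: "inv (Step1 {} x0, [x0])"
proof -
  have "xh \<in> P" "x0 \<in> P" using xh x0 by (auto simp: extreme_point_of_def)
  then show ?thesis
    using x0 by (auto simp: good_rows_def path_to_def simplex_path_def independent_rows_def F_empty)
qed

lemma stage_inv_initial:
  assumes "inv (Step1 E x, p)"
  shows "stage_inv E w 0 x p"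
proof -
  have E: "E \<subseteq> {..<m}" and x: "x \<in> P" using assms F_subset_P by (auto simp: good_rows_def)
  have "real (length p) + dotp n (scaled_cost n w 0) x' - dotp n (scaled_cost n w 0) x
      \<le> real (1 + card E * round_bound + Suc 0 * (n * k))" if "x' \<in> F E" for x'
  proof -
    have "\<bar>real_of_int (scaled_cost n w 0 j)\<bar> \<le> 1" if "j < n" for j
      using abs_scaled_cost_0_le[OF that, of w] by linarith
    then have "\<bar>dotp n (scaled_cost n w 0) x' - dotp n (scaled_cost n w 0) x\<bar> \<le> real n * 1 * real k"
      unfolding dotp_eq_rdot using x F_subset_P[OF E] that by (intro rdot_diff_bound) auto
    moreover have "real (length p) \<le> real (1 + card E * round_bound)"
      using assms by (simp only: of_nat_le_iff inv.simps)
    ultimately show ?thesis unfolding of_nat_add of_nat_mult by simp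
  qed
  then show ?thesis by (simp add: stage_inv_def)
qed

text \<open>The path grows by one vertex while the integral value rises by at least 1, so the
  bounded sum does not grow.\<close>

lemma stage_inv_move:
  assumes inv: "inv (Step3 E w t v, p)" and t: "t \<le> scaling_depth n w"
    and move: "oracle_move n (F E) (scaled_cost n w t) v v'"
  shows "stage_inv E w t v' (p @ [v'])"
proof -
  have E: "E \<subseteq> {..<m}" using inv by (simp add: good_rows_def)
  have "v extreme_point_of P" "v' extreme_point_of P"
    using adjacent_F_imp_P[OF E] move by (auto simp: oracle_move_def adjacent_def)
  then have "dotp n (scaled_cost n w t) v \<in> \<int>" "dotp n (scaled_cost n w t) v' \<in> \<int>"
    using extreme_point_Ints by (auto intro: dotp_Ints)
  then have "dotp n (scaled_cost n w t) v + 1 \<le> dotp n (scaled_cost n w t) v'"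
    using move by (auto simp: oracle_move_def elim!: Ints_cases)
  then show ?thesis
    using inv t by (fastforce simp: stage_inv_def)
qed

lemma stage_inv_optimal:
  assumes inv: "inv (Step3 E w t v, p)" and t: "t \<le> scaling_depth n w"
    and max: "maximizes n (scaled_cost n w t) (F E) v"
  shows "stage_inv E w (Suc t) v p"
proof (cases "t < scaling_depth n w")
  case True
  have E: "E \<subseteq> {..<m}" and v: "v \<in> P" using inv F_subset_P by (auto simp: good_rows_def)
  have "real (length p) + dotp n (scaled_cost n w (Suc t)) x - dotp n (scaled_cost n w (Suc t)) v
      \<le> real (1 + card E * round_bound + Suc (Suc t) * (n * k))" if x: "x \<in> F E" for x
  proof -
    \<comment> \<open>Doubling the cost preserves optimality of \<open>v\<close>, so only this
      correction can open a gap.\<close>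
    let ?d = "\<lambda>j. real_of_int (2 * scaled_cost n w t j - scaled_cost n w (Suc t) j)"
    have d: "rdot n ?d y = 2 * dotp n (scaled_cost n w t) y - dotp n (scaled_cost n w (Suc t)) y" for y
      by (simp add: dotp_eq_rdot rdot_diff_left rdot_scale_left)
    have "\<bar>?d j\<bar> \<le> 1" for j
      using scaled_cost_Suc[OF True, of j] by linarith
    then have "\<bar>rdot n ?d x - rdot n ?d v\<bar> \<le> real n * 1 * real k"
      using x v F_subset_P[OF E] by (intro rdot_diff_bound) auto
    moreover have "dotp n (scaled_cost n w t) x \<le> dotp n (scaled_cost n w t) v"
      using max x by (simp add: maximizes_def)
    ultimately have "dotp n (scaled_cost n w (Suc t)) x - dotp n (scaled_cost n w (Suc t)) v
        \<le> real n * real k"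
      unfolding d by linarith
    moreover have "length p \<le> 1 + card E * round_bound + Suc t * (n * k)"
      using inv t by (intro stage_inv_length) auto
    then have "real (length p) \<le> real (1 + card E * round_bound + Suc t * (n * k))"
      by (simp only: of_nat_le_iff)
    moreover have "real (1 + card E * round_bound + Suc (Suc t) * (n * k))
        = real (1 + card E * round_bound + Suc t * (n * k)) + real n * real k"
      by (simp add: algebra_simps)
    ultimately show ?thesis by linarith
  qed
  then show ?thesis using True by (simp add: stage_inv_def)
next
  \<comment> \<open>The last scaled cost is \<open>w\<close> itself, so this stage ends at an
    optimum of the rounded problem.\<close>
  case False
  then have td: "t = scaling_depth n w" using t by simp
  have E: "good_rows E" "proj E \<noteq> 0" and w: "w = rounded_cost n k (max_entry n m A) (proj E)"
    using inv by auto
  have "length p \<le> 1 + card E * round_bound + Suc t * (n * k)"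
    using inv t by (intro stage_inv_length) auto
  moreover have "Suc t * (n * k) \<le> round_bound"
    using depth_le[OF E] td w by (intro round_bound_ge) simp
  ultimately show ?thesis
    using max by (simp add: stage_inv_def td scaled_cost_final)
qed

text \<open>The point \<open>xh\<close> stays in the face by the rounding argument, \<open>v\<close>
  by complementary slackness as \<open>y h\<close> is positive, and independence follows from
  condition (ii) of Step 3.\<close>

lemma inv_fix_row:
  assumes inv: "inv (Step3 E w (Suc (scaling_depth n w)) v, p)"
    and y: "admissible_dual n m A b E w y"
    and h: "h < m" "y h > real n * real k" "h \<notin> E"
  shows "inv (Step1 (insert h E) v, p)"
proof -
  have gE: "good_rows E" "proj E \<noteq> 0" and w: "w = rounded_cost n k (max_entry n m A) (proj E)"
    and v: "v \<in> F E" "maximizes n w (F E) v" and p: "path_to p v"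
      "length p \<le> 1 + Suc (card E) * round_bound"
    using inv by (auto simp: stage_inv_def)
  have Em: "E \<subseteq> {..<m}" and xhE: "xh \<in> F E" using gE(1) by (auto simp: good_rows_def)
  have hm: "insert h E \<subseteq> {..<m}" using Em h by simp
  have opt: "dual_optimal n m A b E w y" and feas: "dual_feasible n m A E w y"
    using y by (auto simp: admissible_dual_def dual_optimal_def)
  interpret rounded_lp n m k A b c E "proj E" by (rule rounded_lp_proj[OF gE])
  have yh: "y h > 0" using h(2) by (rule order_le_less_trans[rotated]) simp
  have "dotp n (A h) xh = real_of_int (b h)"
    using v(2) opt h xh xhE unfolding w by (intro fixed_row_tight) auto
  then have xh': "xh \<in> F (insert h E)" using xhE by (simp add: F_iff[OF Em] F_iff[OF hm])
  have "(\<Sum>i<m. y i * (real_of_int (b i) - dotp n (A i) v)) = 0"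
    using duality_gap[OF feas, of v] dual_optimal_value[OF Em v(2) opt] by simp
  then have "y h * (real_of_int (b h) - dotp n (A h) v) = 0"
    using dual_slack_nonneg[OF Em v(1) feas] h(1)
    by (subst (asm) sum_nonneg_eq_0_iff) auto
  then have v': "v \<in> F (insert h E)" using v(1) yh by (simp add: F_iff[OF Em] F_iff[OF hm])
  have "\<not> row_in_span n A E h"
    using y yh h by (auto simp: admissible_dual_def)
  then have "independent_rows (insert h E)"
    using gE(1) h(3) finite_good_rows by (intro independent_rows_insert) (auto simp: good_rows_def)
  then show ?thesis
    using xh' v' hm p h(3) finite_good_rows[OF gE(1)] by (simp add: good_rows_def)
qed

text \<open>A zero projection makes \<open>c\<close> constant on the current face, which contains
  the maximizer \<open>xh\<close>.\<close>

lemma inv_stop: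
  assumes inv: "inv (Step1 E x, p)" and z: "proj E = 0"
  shows "inv (Returned x, p)"
proof -
  have E: "good_rows E" and Em: "E \<subseteq> {..<m}" and x: "x \<in> F E" and xhE: "xh \<in> F E"
    using inv by (auto simp: good_rows_def)
  have "dotp n c (xh - x) = rdot n (coord (proj E)) (xh - x)"
    using finite_good_rows[OF E] F_diff_kernel[OF Em xhE x] by (rule orth_proj_props(2))
  then have "dotp n c xh = dotp n c x" by (simp add: z rdot_def)
  then have "maximizes n c P x" using xh(2) x F_subset_P[OF Em] by (auto simp: maximizes_def)
  then show ?thesis using inv inv_length[OF inv] by simp
qed

lemma inv_step:
  assumes "iter_step n m k A b c cf cf'" "inv cf"
  shows "inv cf'"
  using assms
proof (cases rule: iter_step.cases)
  case (stop E x p)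
  then show ?thesis using assms(2) inv_stop by simp
next
  case (round z E w x p)
  then show ?thesis using assms(2) stage_inv_initial by simp
next
  case (scale E w t v p t' v' p')
  have inv: "inv (Step3 E w t v, p)" using assms(2) unfolding scale(1) .
  then have E: "E \<subseteq> {..<m}" by (simp add: good_rows_def)
  from scale(3) show ?thesis
  proof (cases rule: scaling_step.cases)
    case move
    have mv: "oracle_move n (F E) (scaled_cost n w t) v v'" and t: "t \<le> scaling_depth n w"
      using move by simp_all
    then have adj: "adjacent (F E) v v'" by (simp add: oracle_move_def)
    then have "v' \<in> F E" by (simp add: adjacent_def extreme_point_of_def)
    moreover have "path_to (p @ [v']) v'"
      using inv adjacent_F_imp_P[OF E adj] by (auto intro: path_to_snoc)
    moreover have "stage_inv E w t v' (p @ [v'])"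
      using inv t mv by (rule stage_inv_move)
    ultimately show ?thesis
      unfolding scale(2) using inv move by simp
  next
    case optimal
    then have "stage_inv E w (Suc t) v p" using inv by (intro stage_inv_optimal) auto
    then show ?thesis unfolding scale(2) using inv optimal by simp
  qed
next
  case (fix_row t w E y h v p)
  then show ?thesis using assms(2) inv_fix_row by blast
qed

lemma inv_reachable: "(iter_step n m k A b c)\<^sup>*\<^sup>* (Step1 {} x0, [x0]) cf \<Longrightarrow> inv cf"
  by (induction rule: rtranclp_induct) (rule inv_initial, rule inv_step)

section \<open>Termination and final configurations\<close>

fun rank :: "iter_state \<times> rvec list \<Rightarrow> nat" where
  "rank (Step1 E x, p) = length p + card E * (max_depth + 3)"
| "rank (Step3 E w t v, p) = length p + card E * (max_depth + 3) + 1 + t"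
| "rank (Returned x, p) = length p + Suc n * (max_depth + 3)"

lemma stage_le: "inv (Step3 E w t v, p) \<Longrightarrow> t \<le> Suc max_depth"
  using depth_le[of E] by (auto simp: stage_inv_def split: if_splits)

text \<open>Moves raise the length, and ends of stages raise \<open>t\<close>. Within a round the
  term \<open>1 + t\<close> is at most \<open>max_depth + 2\<close>, so the weight
  \<open>max_depth + 3\<close> of a newly fixed row outweighs its loss.\<close>

lemma rank_step:
  assumes "iter_step n m k A b c cf cf'" "inv cf"
  shows "rank cf < rank cf'"
  using assms(1)
proof (cases rule: iter_step.cases)
  case (stop E x p)
  then have "card E \<le> n" using assms(2) card_good_rows by simp
  then have "card E * (max_depth + 3) < Suc n * (max_depth + 3)"
    by (intro mult_strict_right_mono) auto
  then show ?thesis using stop by simp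
next
  case (scale E w t v p t' v' p')
  from scale(3) show ?thesis by (cases rule: scaling_step.cases) (auto simp: scale)
next
  case (fix_row t w E y h v p)
  then have "t \<le> Suc max_depth" "finite E"
    using assms(2) stage_le finite_good_rows by auto
  then show ?thesis using fix_row by simp
qed simp

lemma rank_le:
  assumes "inv cf"
  shows "rank cf \<le> 1 + Suc n * round_bound + Suc n * (max_depth + 3)"
proof -
  obtain s p where cf: "cf = (s, p)" by (cases cf)
  have len: "length p \<le> 1 + Suc n * round_bound"
    using assms unfolding cf by (rule inv_length)
  have rows: "card E * (max_depth + 3) + (max_depth + 3) \<le> Suc n * (max_depth + 3)"
    if "good_rows E" for E
    using mult_right_mono[of "Suc (card E)" "Suc n" "max_depth + 3"] card_good_rows[OF that] by simp
  show ?thesis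
  proof (cases s)
    case (Step1 E x)
    then have "good_rows E" using assms cf by simp
    from rows[OF this] len show ?thesis unfolding cf Step1 rank.simps by linarith
  next
    case (Step3 E w t v)
    then have "good_rows E" "t \<le> Suc max_depth" using assms cf stage_le by auto
    with rows[of E] len show ?thesis unfolding cf Step3 rank.simps by linarith
  next
    case (Returned x)
    then show ?thesis using len unfolding cf Returned rank.simps by linarith
  qed
qed

lemma terminating:
  "\<nexists>f. f 0 = (Step1 {} x0, [x0]) \<and> (\<forall>i::nat. iter_step n m k A b c (f i) (f (Suc i)))"
proof
  assume "\<exists>f. f 0 = (Step1 {} x0, [x0]) \<and> (\<forall>i::nat. iter_step n m k A b c (f i) (f (Suc i)))"
  then obtain f where f0: "f 0 = (Step1 {} x0, [x0])"
    and f: "\<And>i::nat. iter_step n m k A b c (f i) (f (Suc i))" by blast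
  have inv: "inv (f i)" for i
    by (induction i) (simp only: f0 inv_initial, rule inv_step[OF f])
  have "i \<le> rank (f i)" for i
  proof (induction i)
    case (Suc i)
    then show ?case using rank_step[OF f inv, of i] by simp
  qed simp
  from this[of "Suc (1 + Suc n * round_bound + Suc n * (max_depth + 3))"] rank_le[OF inv]
  show False by (meson not_less_eq_eq order_trans)
qed

text \<open>Progress: an improving neighbour or the end of a stage, an admissible dual and, for
  \<open>n >= 2\<close>, a large dual entry always exist. For \<open>n = 1\<close> only the last of
  these may be missing.\<close>

lemma stuck:
  assumes inv: "inv (s, p)" and stuck: "\<nexists>cf. iter_step n m k A b c (s, p) cf"
  shows "maximizes n c P (last p)" "2 \<le> n \<Longrightarrow> s = Returned (last p)"
proof -
  have "maximizes n c P (last p) \<and> (2 \<le> n \<longrightarrow> s = Returned (last p))"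
  proof (cases s)
    case (Step1 E x)
    then show ?thesis using stuck by (meson iter_step.stop iter_step.round)
  next
    case (Step3 E w t v)
    have gE: "good_rows E" "proj E \<noteq> 0" and w: "w = rounded_cost n k (max_entry n m A) (proj E)"
      and vF: "v \<in> F E" and p: "path_to p v" and stage: "stage_inv E w t v p"
      using inv Step3 by auto
    have Em: "E \<subseteq> {..<m}" and xhE: "xh \<in> F E" using gE(1) by (auto simp: good_rows_def)
    interpret rounded_lp n m k A b c E "proj E" by (rule rounded_lp_proj[OF gE])
    have "\<not> t \<le> scaling_depth n w"
    proof
      assume t: "t \<le> scaling_depth n w"
      have "\<exists>cf. scaling_step n (F E) w (t, v, p) cf"
      proof (cases "maximizes n (scaled_cost n w t) (F E) v")
        case True
        then show ?thesis using t by (blast intro: scaling_step.optimal)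
      next
        case False
        then obtain v' where "oracle_move n (F E) (scaled_cost n w t) v v'"
          using not_maximizes_imp_move[OF Em extreme_F[OF gE(1) vF p]] by blast
        then show ?thesis using t by (blast intro: scaling_step.move)
      qed
      then obtain t' v' p' where "scaling_step n (F E) w (t, v, p) (t', v', p')" by auto
      then show False using stuck Step3 iter_step.scale by blast
    qed
    then have t: "t = Suc (scaling_depth n w)" and max: "maximizes n w (F E) v"
      using stage by (auto simp: stage_inv_def)
    obtain y where y: "admissible_dual n m A b E w y"
      using exists_admissible_dual[OF Em max] by blast
    have "\<not> 2 \<le> n"
    proof
      assume "2 \<le> n"
      moreover have "dual_feasible n m A E w y" "card {i \<in> {..<m}. y i \<noteq> 0} \<le> n"
        using y by (auto simp: admissible_dual_def dual_optimal_def)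
      ultimately obtain h where "h < m" "h \<notin> E" "y h > real n * real k"
        using exists_large_dual_entry unfolding w by blast
      then show False using stuck Step3 iter_step.fix_row[OF t y] by blast
    qed
    then have "n = 1" using n by simp
    then have "maximizes n c P v"
      using max xhE xh(2) unfolding w by (rule maximizes_c_dim_1)
    then show ?thesis using p \<open>\<not> 2 \<le> n\<close> by (simp add: path_to_def)
  next
    case (Returned x)
    then show ?thesis using inv by (simp add: path_to_def)
  qed
  then show "maximizes n c P (last p)" "2 \<le> n \<Longrightarrow> s = Returned (last p)" by blast+
qed

lemma inv_path_to: "inv (s, p) \<Longrightarrow> path_to p (last p)"
  by (cases s) (auto simp: path_to_def)

lemma path_length_bound:
  assumes "inv (s, p)" and L: "2 \<le> real n * real k * real_of_int (max_entry n m A)"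
  shows "real (length p - 1)
    \<le> 10 * real n ^ 2 * real k * log 2 (real n * real k * real_of_int (max_entry n m A))"
proof -
  let ?x = "real n * real k * real_of_int (max_entry n m A)"
  let ?q = "real n ^ 3 * real k * real_of_int (max_entry n m A)"
  define L where "L = log 2 ?x"
  have n1: "1 \<le> real n" "1 \<le> real k" "1 \<le> real_of_int (max_entry n m A)"
    using n k \<alpha> by linarith+
  \<comment> \<open>The assumption \<open>2 <= n k \<alpha>\<close> lets \<open>L\<close> absorb
    additive constants.\<close>
  have "1 \<le> L" unfolding L_def using L by (subst le_log_iff) auto
  have qpos: "0 < ?q" using n k \<alpha> by simp
  \<comment> \<open>A crude cubic bound suffices, as it costs only a factor 3 in the
    logarithm.\<close>
  have "?q \<le> real n ^ 3 * real k ^ 3 * real_of_int (max_entry n m A) ^ 3"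
    using n1 self_le_power[of "real k" 3] self_le_power[of "real_of_int (max_entry n m A)" 3]
    by (intro mult_mono) auto
  also have "\<dots> = ?x ^ 3" by (simp add: power_mult_distrib)
  finally have "log 2 ?q \<le> log 2 (?x ^ 3)" using qpos by (intro log_mono) auto
  also have "\<dots> = 3 * L" using L by (simp add: L_def log_nat_power)
  finally have "log 2 ?q \<le> 3 * L" .
  moreover have "real max_depth < log 2 ?q + 1 \<or> max_depth = 0"
    unfolding max_depth_def by linarith
  \<comment> \<open>The ceiling and \<open>Suc\<close> add at most 2, hence at most
    \<open>2 * L\<close>. Together with \<open>n + 1 <= 2 n\<close> this gives the constant
    10.\<close>
  ultimately have "real (Suc max_depth) \<le> 5 * L" using \<open>1 \<le> L\<close> by auto
  moreover have "real (Suc n) \<le> 2 * real n" using n1 by simp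
  ultimately have "real (Suc n) * (real (Suc max_depth) * (real n * real k))
      \<le> (2 * real n) * (5 * L * (real n * real k))"
    by (intro mult_mono) auto
  moreover have "length p - 1 \<le> Suc n * round_bound" using inv_length[OF assms(1)] by simp
  then have "real (length p - 1) \<le> real (Suc n * round_bound)" by (simp only: of_nat_le_iff)
  then have "real (length p - 1) \<le> real (Suc n) * (real (Suc max_depth) * (real n * real k))"
    unfolding round_bound_def of_nat_mult .
  ultimately have "real (length p - 1) \<le> (2 * real n) * (5 * L * (real n * real k))" by linarith
  also have "\<dots> = 10 * real n ^ 2 * real k * L" by (simp add: power2_eq_square)
  finally show ?thesis unfolding L_def .
qed

end

theorem theorem2:
  shows "\<exists>C::real. C > 0 \<and>
    (\<forall>(n::nat) (m::nat) (k::nat) (A::imat) (b::ivec) (P::rvec set) (\<alpha>::int) (c::ivec) (x0::rvec).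
       n > 0 \<longrightarrow> m > 0 \<longrightarrow> k > 0 \<longrightarrow>
       P = polyhedron_of n m A b \<longrightarrow> box_polytope n k P \<longrightarrow>
       \<alpha> = max_entry n m A \<longrightarrow> int n * int k * \<alpha> \<ge> 2 \<longrightarrow>
       x0 extreme_point_of P \<longrightarrow>
       (\<nexists>f. f 0 = (Step1 {} x0, [x0]) \<and> (\<forall>i::nat. iter_step n m k A b c (f i) (f (Suc i)))) \<and>
       (\<forall>s p. (iter_step n m k A b c)\<^sup>*\<^sup>* (Step1 {} x0, [x0]) (s, p) \<and>
              (\<nexists>cf. iter_step n m k A b c (s, p) cf) \<longrightarrow>
          simplex_path P p \<and> hd p = x0 \<and>
          last p extreme_point_of P \<and> maximizes n c P (last p) \<and>
          real (length p - 1)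
            \<le> C * real n ^ 2 * real k * log 2 (real n * real k * real_of_int \<alpha>) \<and>
          (n \<ge> 2 \<longrightarrow> s = Returned (last p))))"
proof (intro exI[of _ 10] conjI[of "(10::real) > 0"] allI impI)
  fix n m k :: nat and A :: imat and b c :: ivec and P :: "rvec set" and \<alpha> :: int and x0 :: rvec
  assume pos: "n > 0" "m > 0" "k > 0" and P: "P = polyhedron_of n m A b" and box: "box_polytope n k P"
    and \<alpha>_eq: "\<alpha> = max_entry n m A" and ge2: "int n * int k * \<alpha> \<ge> 2" and x0: "x0 extreme_point_of P"
  interpret lattice_lp n m k A b using box P by unfold_locales simp
  obtain xh where xh: "xh extreme_point_of P" "maximizes n c P xh"
    using exists_maximal_vertex x0 unfolding P by blast
  have "0 < int n * int k * \<alpha>" using ge2 by simp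
  then have "0 < \<alpha>" using pos by (intro zero_less_mult_pos[of "int n * int k" \<alpha>]) auto
  then interpret iteration n m k A b c x0 xh
    using pos x0 xh unfolding P \<alpha>_eq by unfold_locales
  have "2 \<le> real_of_int (int n * int k * \<alpha>)" using ge2 by linarith
  then have ge2': "2 \<le> real n * real k * real_of_int (max_entry n m A)" by (simp add: \<alpha>_eq)
  have result: "simplex_path P p \<and> hd p = x0 \<and> last p extreme_point_of P \<and> maximizes n c P (last p) \<and>
      real (length p - 1) \<le> 10 * real n ^ 2 * real k * log 2 (real n * real k * real_of_int \<alpha>) \<and>
      (n \<ge> 2 \<longrightarrow> s = Returned (last p))"
    if "(iter_step n m k A b c)\<^sup>*\<^sup>* (Step1 {} x0, [x0]) (s, p)"
      "\<nexists>cf. iter_step n m k A b c (s, p) cf" for s p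
  proof -
    have inv: "inv (s, p)" using that(1) by (rule inv_reachable)
    show ?thesis
      using inv_path_to[OF inv] path_to_extreme[OF inv_path_to[OF inv]] stuck[OF inv that(2)]
        path_length_bound[OF inv ge2']
      unfolding P \<alpha>_eq by (simp add: path_to_def)
  qed
  show "(\<nexists>f. f 0 = (Step1 {} x0, [x0]) \<and> (\<forall>i::nat. iter_step n m k A b c (f i) (f (Suc i)))) \<and>
       (\<forall>s p. (iter_step n m k A b c)\<^sup>*\<^sup>* (Step1 {} x0, [x0]) (s, p) \<and>
              (\<nexists>cf. iter_step n m k A b c (s, p) cf) \<longrightarrow>
          simplex_path P p \<and> hd p = x0 \<and>
          last p extreme_point_of P \<and> maximizes n c P (last p) \<and>
          real (length p - 1)
            \<le> 10 * real n ^ 2 * real k * log 2 (real n * real k * real_of_int \<alpha>) \<and>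
          (n \<ge> 2 \<longrightarrow> s = Returned (last p)))"
    using terminating result by blast
qed simp

end
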